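(* Let $N\ge 1$ and let $\mathbf{m}=(m_1<\cdots<m_N)$ and $\mathbf{n}=(n_1<\cdots<n_N)$ be distinct $N$-tuples of real numbers with strictly increasing entries such that $m_j\le n_j$ for all $j$. Then the symmetric function $$f:(0,\infty)^N_{\neq}\to\mathbb{R};\quad \mathbf{u}\mapsto\frac{\det\mathbf{u}^{\circ\mathbf{n}}}{\det\mathbf{u}^{\circ\mathbf{m}}}$$ is strictly increasing in each coordinate. Moreover, when $\mathbf{m}$ and $\mathbf{n}$ also have non-negative-integer entries, this coordinate-wise strict monotonicity holds for the (unique continuous) extension of $f$ to all of $(0,\infty)^N$.
   Context: $(0,\infty)^N_{\neq}$ is the set of $N$-tuples of pairwise distinct elements of $(0,\infty)$. For $\mathbf{u}=(u_1,\ldots,u_N)\in(0,\infty)^N$ and $\mathbf{m}\in\mathbb{R}^N$, $\mathbf{u}^{\circ\mathbf{m}}:=(u_i^{m_j})_{i,j=1}^N$. A function on a set $X\subseteq\mathbb{R}^N$ is strictly increasing in each coordinate if $f(\mathbf{u})<f(\mathbf{v})$ whenever $\mathbf{u},\mathbf{v}\in X$ differ in exactly one coordinate $i$ and $u_i<v_i$. When $\mathbf{m}$ and $\mathbf{n}$ have non-negative-integer entries, $f(\mathbf{u})=s_{\mathbf{n}}(\mathbf{u})/s_{\mathbf{m}}(\mathbf{u})$, and this ratio gives the extension to $(0,\infty)^N$, where the Schur polynomial $s_{\mathbf{n}}(u_1,\ldots,u_N)$ is the unique polynomial extension of $\det(u_i^{n_j})_{i,j=1}^N/\det(u_i^{j-1})_{i,j=1}^N$.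 *)

theory Defs
  imports "HOL-Analysis.Analysis"
begin

text \<open>
  Tuples of length \<open>N\<close> are vectors \<open>real ^ 'n\<close> over a finite linearly ordered index type, with
  \<open>N = CARD('n)\<close>; the order on \<open>'n\<close> is the order of the coordinates.
\<close>

definition pos_orthant :: "(real ^ 'n) set" where
  "pos_orthant = {u. \<forall>i. 0 < u $ i}"

definition pos_orthant_distinct :: "(real ^ 'n) set" where
  "pos_orthant_distinct = {u \<in> pos_orthant. inj (($) u)}"

definition entrywise_powr :: "real ^ 'n \<Rightarrow> real ^ 'n \<Rightarrow> real ^ 'n ^ 'n" where
  "entrywise_powr u m = (\<chi> i j. u $ i powr m $ j)"

definition det_ratio :: "real ^ 'n \<Rightarrow> real ^ 'n \<Rightarrow> real ^ 'n \<Rightarrow> real" where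
  "det_ratio m n u = det (entrywise_powr u n) / det (entrywise_powr u m)"

definition strictly_increasing_each_coord_on ::
    "(real ^ 'n) set \<Rightarrow> (real ^ 'n \<Rightarrow> real) \<Rightarrow> bool" where
  "strictly_increasing_each_coord_on X f \<longleftrightarrow>
     (\<forall>u\<in>X. \<forall>v\<in>X. \<forall>i. u $ i < v $ i \<and> (\<forall>j. j \<noteq> i \<longrightarrow> u $ j = v $ j) \<longrightarrow> f u < f v)"

definition symmetric_on :: "(real ^ 'n) set \<Rightarrow> (real ^ 'n \<Rightarrow> real) \<Rightarrow> bool" where
  "symmetric_on X f \<longleftrightarrow>
     (\<forall>u\<in>X. \<forall>p. p permutes UNIV \<longrightarrow> f (\<chi> i. u $ p i) = f u)"

text \<open>
  The Schur polynomial, as a polynomial function. The exponent \<open>card {k. k < j}\<close> is the zero-based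
  position of \<open>j\<close>, so the denominator is the Vandermonde determinant. Here \<open>a\<close> is the strictly
  increasing tuple of exponents, i.e. the partition shifted by the staircase \<open>(0, \<dots>, N - 1)\<close>.
  The quotient prescribes the values on tuples with distinct real entries; as these are dense,
  at most one polynomial function extends it.
\<close>

definition schur :: "nat ^ ('n::{finite, linorder}) \<Rightarrow> real ^ ('n::{finite, linorder}) \<Rightarrow> real" where
  "schur a = (THE p. real_polynomial_function p \<and>
     (\<forall>u. inj (($) u) \<longrightarrow>
        p u = det (\<chi> i j. u $ i ^ (a $ j)) / det (\<chi> i j. u $ i ^ card {k. k < j})))"

end

theory Submission
  imports Defs
begin

text \<open>
View \<open>det (entrywise_powr u m)\<close> as a function \<open>P\<^sub>m\<close> of one coordinate \<open>t = u $ i\<close>. Expanding along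
row \<open>i\<close> turns it into a generalized polynomial \<open>\<Sum>\<^sub>k C\<^sub>k t powr (m $ k)\<close>, whose coefficients are
minors in the other coordinates, and it vanishes when \<open>t\<close> equals one of these. Rolle's theorem shows
that a generalized polynomial with \<open>N\<close> terms has fewer than \<open>N\<close> positive zeros
(\<open>gpoly_card_zeros\<close>); this makes the determinants nonzero. In the extremal case of exactly
\<open>N - 1\<close> positive zeros, they are all simple, the coefficients alternate in sign, and a
single coefficient determines the sign of the function everywhere (\<open>gpoly_sgn\<close>).

For the monotonicity, move from \<open>m\<close> to \<open>n\<close> by raising one exponent at a time, the largest differing
index first, so that the exponents stay increasing. The ratio factors accordingly, and a product of
positive increasing functions is increasing. Let only the exponent with index \<open>k\<close> be raised. For
\<open>s < t\<close> the sign of the difference of the two ratios is that of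
\<open>P\<^sub>m(s) P\<^sub>n(t) - P\<^sub>n(s) P\<^sub>m(t)\<close> divided by \<open>P\<^sub>m(s) P\<^sub>m(t)\<close>. The numerator is a generalized polynomial in
\<open>t\<close> with \<open>N + 1\<close> exponents, and it vanishes at \<open>s\<close> and at the other \<open>N - 1\<close> coordinates: again the
extremal case. Its coefficient at the new exponent is \<open>P\<^sub>m(s) C\<^sub>k\<close>, where \<open>C\<^sub>k\<close> is the same minor for
\<open>m\<close> and \<open>n\<close>. Hence its sign is that of \<open>P\<^sub>m(s) P\<^sub>m(t) (t - s)\<close>
(\<open>det_ratio_raise_one_less\<close>). Only \<open>s\<close> and \<open>t\<close> themselves have to avoid the other coordinates; the
interval between them need not.

For integer exponents, a polynomial function that vanishes on \<open>u $ i = u $ j\<close> is a multiple of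
\<open>u $ i - u $ j\<close>, so the alternants are divisible by the product of all differences
(\<open>alternant_divisible\<close>). The Vandermonde quotient is homogeneous of degree \<open>0\<close>, hence constant, and
Schur polynomials exist. At positive tuples of distinct entries, a Schur polynomial is itself a ratio
of the kind above, with the staircase as lower exponents; so, by continuity, it is weakly increasing
on the whole positive orthant, and comparison with a smaller tuple of distinct entries makes it
positive everywhere (\<open>schur_pos\<close>).

The ratio of two Schur polynomials is then weakly increasing by continuity. If it took the same value
at two points of a line in direction \<open>i\<close>, it would be constant between them, and the two Schur
polynomials would be proportional as polynomials in \<open>t\<close>. After multiplication by
\<open>\<Prod>\<^sub>j (t - u $ j)\<close>, over \<open>j \<noteq> i\<close>, both have only exponents from their own tuple
(\<open>schur_coord_poly\<close>), so only common exponents remain. These are at most \<open>N - 1\<close>, as the tuples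
differ. But \<open>N - 1\<close> positive roots, counted with multiplicity, force at least \<open>N\<close> terms
(\<open>card_pos_linear_factors_less\<close>), a contradiction.
\<close>

section \<open>Zeros and signs of generalized polynomials\<close>

text \<open>
The zeros of the derivative are picked strictly between neighbouring zeros, which also makes them new.
The clause \<open>\<exists>z\<in>Z. w < z\<close> serves the induction: a further zero beyond the old ones cannot interfere
with the points chosen before.
\<close>

lemma rolle_zeros:
  fixes h h' :: "real \<Rightarrow> real"
  assumes "finite Z" "Z \<subseteq> {0<..}" "\<forall>z\<in>Z. h z = 0"
    and der: "\<And>t. 0 < t \<Longrightarrow> (h has_real_derivative h' t) (at t)"
  shows "\<exists>Z'. finite Z' \<and> Z' \<subseteq> {0<..} \<and> Z \<inter> Z' = {} \<and> (\<forall>w\<in>Z'. h' w = 0)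
    \<and> (\<forall>w\<in>Z'. \<exists>z\<in>Z. w < z) \<and> card Z \<le> Suc (card Z')"
  using assms(1-3)
proof (induction Z rule: finite_linorder_max_induct)
  case empty
  then show ?case by (intro exI[of _ "{}"]) auto
next
  case (insert b A)
  show ?case
  proof (cases "A = {}")
    case True
    then show ?thesis by (intro exI[of _ "{}"]) auto
  next
    case False
    obtain Z' where Z': "finite Z'" "Z' \<subseteq> {0<..}" "A \<inter> Z' = {}" "\<forall>w\<in>Z'. h' w = 0"
      "\<forall>w\<in>Z'. \<exists>z\<in>A. w < z" "card A \<le> Suc (card Z')"
      using insert by auto
    define a where "a = Max A"
    have a: "a \<in> A" "\<forall>x\<in>A. x \<le> a" using False insert.hyps by (auto simp: a_def)
    have "0 < a" "a < b" using a insert by auto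
    have "\<exists>w. a < w \<and> w < b \<and> h' w = 0"
    proof -
      have "\<exists>w>a. w < b \<and> (h has_real_derivative 0) (at w)"
      proof (rule Rolle)
        show "a < b" by fact
        show "h a = h b" using a insert.prems by auto
        show "continuous_on {a..b} h"
          using der \<open>0 < a\<close> by (intro DERIV_continuous_on[where D=h']) (auto intro: has_field_derivative_at_within)
        show "h differentiable (at x)" if "a < x" "x < b" for x
          using der[of x] that \<open>0 < a\<close> by (auto simp: real_differentiable_def)
      qed
      then show ?thesis using der \<open>0 < a\<close> by (metis DERIV_unique less_trans)
    qed
    then obtain w where w: "a < w" "w < b" "h' w = 0" by blast
    have "w \<notin> Z'" "b \<notin> Z'" "w \<notin> A" using w Z'(5) a insert.hyps by force+
    moreover have "w \<noteq> b" "b \<notin> A" "0 < w" using w \<open>0 < a\<close> insert.hyps by auto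
    moreover have "card (insert b A) \<le> Suc (card (insert w Z'))"
      using Z' insert.hyps \<open>w \<notin> Z'\<close> \<open>b \<notin> A\<close> by simp
    moreover have "\<forall>x\<in>insert w Z'. \<exists>z\<in>insert b A. x < z" using Z'(5) w by auto
    moreover have "insert b A \<inter> insert w Z' = {}" using calculation Z'(3) by simp
    ultimately show ?thesis using Z'(1,2,4) w
      by (intro exI[of _ "insert w Z'"] conjI) simp_all
  qed
qed

text \<open>
Rolle's theorem for \<open>t powr (- a) * g t\<close>, whose derivative is a positive multiple of
\<open>t * g' t - a * g t\<close>. In this form the differential operator \<open>t g' - a g\<close> preserves the exponents of
a generalized polynomial and removes the exponent \<open>a\<close>.
\<close>

lemma euler_rolle:
  fixes g g' :: "real \<Rightarrow> real" and a :: real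
  assumes "finite Z" "Z \<subseteq> {0<..}" "\<forall>z\<in>Z. g z = 0"
    and der: "\<And>t. 0 < t \<Longrightarrow> (g has_real_derivative g' t) (at t)"
  shows "\<exists>Z'. finite Z' \<and> Z' \<subseteq> {0<..} \<and> Z \<inter> Z' = {} \<and> (\<forall>w\<in>Z'. w * g' w = a * g w)
    \<and> card Z \<le> Suc (card Z')"
proof -
  define h' where "h' t = t powr (-a-1) * (t * g' t - a * g t)" for t
  have "((\<lambda>t. t powr (-a) * g t) has_real_derivative h' t) (at t)" if "0 < t" for t
  proof -
    have "((\<lambda>t. t powr (-a) * g t) has_real_derivative
        ((-a) * t powr (-a-1)) * g t + g' t * t powr (-a)) (at t)"
      using has_real_derivative_powr[OF that, of "-a"] der[OF that] by (rule DERIV_mult)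
    moreover have "t powr (-a) = t * t powr (-a-1)"
      using that by (simp add: powr_diff)
    ultimately show ?thesis by (simp add: h'_def algebra_simps)
  qed
  from rolle_zeros[OF assms(1,2) _ this] assms(3)
  obtain Z' where Z': "finite Z'" "Z' \<subseteq> {0<..}" "Z \<inter> Z' = {}" "\<forall>w\<in>Z'. h' w = 0"
    "card Z \<le> Suc (card Z')" by auto
  have "w * g' w = a * g w" if "w \<in> Z'" for w
    using Z'(2,4) that by (auto simp: h'_def)
  then show ?thesis using Z' by (intro exI[of _ Z'] conjI ballI)
qed

text \<open>
A generalized polynomial is given by a set of exponents and a coefficient function on the reals, not
by an indexed family: then terms can be removed and families with common exponents can be subtracted
without renumbering.
\<close>

definition gpoly :: "real set \<Rightarrow> (real \<Rightarrow> real) \<Rightarrow> real \<Rightarrow> real" where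
  "gpoly E c t = (\<Sum>e\<in>E. c e * t powr e)"

definition gpoly_deriv :: "real set \<Rightarrow> (real \<Rightarrow> real) \<Rightarrow> real \<Rightarrow> real" where
  "gpoly_deriv E c t = (\<Sum>e\<in>E. c e * (e * t powr (e - 1)))"

lemma gpoly_has_derivative:
  assumes "0 < t"
  shows "(gpoly E c has_real_derivative gpoly_deriv E c t) (at t)"
proof -
  have "((\<lambda>t. c e * t powr e) has_real_derivative c e * (e * t powr (e - 1))) (at t)" for e
    using has_real_derivative_powr[OF assms, of e] by (rule DERIV_cmult)
  then show ?thesis
    unfolding gpoly_def[abs_def] gpoly_deriv_def by (rule DERIV_sum)
qed

lemma gpoly_euler:
  assumes "0 < t" "finite E"
  shows "t * gpoly_deriv E c t - a * gpoly E c t = gpoly (E - {a}) (\<lambda>e. c e * (e - a)) t"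
proof -
  have "t * gpoly_deriv E c t - a * gpoly E c t = gpoly E (\<lambda>e. c e * (e - a)) t"
    using assms unfolding gpoly_def gpoly_deriv_def
    by (simp add: sum_distrib_left sum_subtractf[symmetric] powr_diff algebra_simps)
  also have "\<dots> = gpoly (E - {a}) (\<lambda>e. c e * (e - a)) t"
    unfolding gpoly_def using assms by (intro sum.mono_neutral_right) auto
  finally show ?thesis .
qed

lemma gpoly_single:
  assumes "finite E" "a \<in> E" "\<forall>e\<in>E-{a}. c e = 0"
  shows "gpoly E c t = c a * t powr a"
proof -
  have "gpoly E c t = gpoly {a} c t"
    unfolding gpoly_def using assms by (intro sum.mono_neutral_right) auto
  then show ?thesis by (simp add: gpoly_def)
qed

text \<open>
Induction on the number of terms: the operator of \<open>gpoly_euler\<close> removes one term and by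
\<open>euler_rolle\<close> loses at most one zero.
\<close>

lemma gpoly_card_zeros:
  assumes "finite E" "finite Z" "Z \<subseteq> {0<..}" "\<forall>z\<in>Z. gpoly E c z = 0" "\<exists>e\<in>E. c e \<noteq> 0"
  shows "card Z < card E"
  using assms
proof (induction E arbitrary: c Z rule: finite_induct)
  case empty
  then show ?case by auto
next
  case (insert a A)
  have A: "insert a A - {a} = A" using insert.hyps by auto
  show ?case
  proof (cases "\<forall>e\<in>A. c e = 0")
    case True
    then have "c a \<noteq> 0" using insert.prems by auto
    have "gpoly (insert a A) c t = c a * t powr a" for t
      by (rule gpoly_single) (use True insert A in auto)
    then have "Z = {}" using insert.prems \<open>c a \<noteq> 0\<close> by force
    then show ?thesis using insert.hyps by simp
  next
    case False
    obtain Z' where Z': "finite Z'" "Z' \<subseteq> {0<..}" "card Z \<le> Suc (card Z')"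
      "\<forall>w\<in>Z'. w * gpoly_deriv (insert a A) c w = a * gpoly (insert a A) c w"
      using euler_rolle[OF insert.prems(1-3) gpoly_has_derivative, where a=a] by blast
    have "\<forall>w\<in>Z'. gpoly A (\<lambda>e. c e * (e - a)) w = 0"
      using gpoly_euler[of _ "insert a A" c a] Z' insert.hyps A by force
    then have "card Z' < card A"
      using Z' False insert.hyps by (intro insert.IH[of Z' "\<lambda>e. c e * (e - a)"]) auto
    then show ?thesis using Z' insert.hyps by simp
  qed
qed

text \<open>
A double zero would survive the operator of \<open>gpoly_euler\<close> in addition to the zeros supplied by Rolle's
theorem, and the remaining terms would have too many zeros.
\<close>

lemma gpoly_simple_zero:
  assumes E: "finite E" "finite Z" "Z \<subseteq> {0<..}" "\<forall>z\<in>Z. gpoly E c z = 0" "\<exists>e\<in>E. c e \<noteq> 0"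
    and card: "card E = Suc (card Z)" and z: "z \<in> Z"
  shows "gpoly_deriv E c z \<noteq> 0"
proof
  assume der: "gpoly_deriv E c z = 0"
  obtain a where a: "a \<in> E" using E by auto
  obtain Z' where Z': "finite Z'" "Z' \<subseteq> {0<..}" "card Z \<le> Suc (card Z')" "Z \<inter> Z' = {}"
      "\<forall>w\<in>Z'. w * gpoly_deriv E c w = a * gpoly E c w"
    using euler_rolle[OF E(2-4) gpoly_has_derivative, where a=a] by blast
  have "\<forall>w\<in>insert z Z'. gpoly (E - {a}) (\<lambda>e. c e * (e - a)) w = 0"
    using gpoly_euler[of _ E c a] Z' E der z by force
  moreover have "\<exists>e\<in>E-{a}. c e * (e - a) \<noteq> 0"
  proof (rule ccontr)
    assume "\<not> ?thesis"
    then have *: "\<forall>e\<in>E-{a}. c e = 0" by auto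
    then have "c a \<noteq> 0" using E by auto
    then show False using gpoly_single[OF E(1) a *, of z] E z by force
  qed
  ultimately have "card (insert z Z') < card (E - {a})"
    using Z' E z by (intro gpoly_card_zeros[where c="\<lambda>e. c e * (e - a)"]) auto
  moreover have "z \<notin> Z'" using Z'(4) z by auto
  ultimately show False using Z'(1,3) a card E(1) by simp
qed

text \<open>
The difference quotient \<open>g t / (t - z)\<close> tends to \<open>D\<close>, so it has the sign of \<open>D\<close> near \<open>z\<close>.
\<close>

lemma sgn_near_simple_zero:
  fixes g :: "real \<Rightarrow> real"
  assumes "(g has_real_derivative D) (at z)" "g z = 0" "D \<noteq> 0"
  shows "\<forall>\<^sub>F t in at z. sgn (g t) = sgn D * sgn (t - z)"
proof -
  have "((\<lambda>t. g t / (t - z)) \<longlongrightarrow> D) (at z)"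
    using assms by (simp add: has_field_derivative_iff)
  then have "((\<lambda>t. (g t / (t - z)) * D) \<longlongrightarrow> D * D) (at z)"
    by (intro tendsto_intros)
  then have "\<forall>\<^sub>F t in at z. (g t / (t - z)) * D > 0"
    by (rule order_tendstoD) (use assms in \<open>auto simp: zero_less_mult_iff\<close>)
  moreover have "\<forall>\<^sub>F t in at z. t \<noteq> z" by (simp add: eventually_at_filter)
  ultimately show ?thesis
  proof eventually_elim
    case (elim t)
    then show ?case
      by (cases "t < z") (auto simp: sgn_if zero_less_mult_iff mult_less_0_iff zero_less_divide_iff divide_less_0_iff split: if_splits)
  qed
qed

lemma prod_sgn_locally_const:
  fixes Z :: "real set"
  assumes "finite Z" "x \<notin> Z"
  shows "\<forall>\<^sub>F t in at x. (\<Prod>z\<in>Z. sgn (t - z)) = (\<Prod>z\<in>Z. sgn (x - z))"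
proof -
  have "\<forall>\<^sub>F t in at x. \<forall>z\<in>Z. sgn (t - z) = sgn (x - z)"
    unfolding eventually_ball_finite_distrib[OF assms(1)]
  proof
    fix z assume "z \<in> Z"
    then have "x < z \<or> z < x" using assms by (metis linorder_neqE)
    then show "\<forall>\<^sub>F t in at x. sgn (t - z) = sgn (x - z)"
    proof
      assume "x < z"
      then have "\<forall>\<^sub>F t in at x. t < z"
        by (intro order_tendstoD(2)[OF tendsto_ident_at])
      then show ?thesis by eventually_elim (use \<open>x < z\<close> in auto)
    next
      assume "z < x"
      then have "\<forall>\<^sub>F t in at x. z < t"
        by (intro order_tendstoD(1)[OF tendsto_ident_at])
      then show ?thesis by eventually_elim (use \<open>z < x\<close> in auto)
    qed
  qed
  then show ?thesis by eventually_elim (auto intro: prod.cong)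
qed

lemma sgn_locally_const:
  fixes g :: "real \<Rightarrow> real"
  assumes "isCont g x" "g x \<noteq> 0"
  shows "\<forall>\<^sub>F t in at x. sgn (g t) = sgn (g x)"
proof -
  have "((\<lambda>t. g t * g x) \<longlongrightarrow> g x * g x) (at x)"
    using assms by (intro tendsto_intros) (auto simp: isCont_def)
  then have "\<forall>\<^sub>F t in at x. g t * g x > 0"
    by (rule order_tendstoD) (use assms in \<open>auto simp: zero_less_mult_iff\<close>)
  then show ?thesis
    by eventually_elim (auto simp: sgn_if zero_less_mult_iff)
qed

text \<open>
All sign changes are explained by the zeros: dividing the sign by those of the linear factors
leaves a function that is locally constant on the connected set of positive reals.
\<close>

lemma gpoly_sgn_const:
  assumes E: "finite E" "finite Z" "Z \<subseteq> {0<..}" "\<forall>z\<in>Z. gpoly E c z = 0" "\<exists>e\<in>E. c e \<noteq> 0"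
    and card: "card E = Suc (card Z)"
  shows "\<exists>s. \<forall>t>0. sgn (gpoly E c t) = s * (\<Prod>z\<in>Z. sgn (t - z))"
proof -
  define g where "g = gpoly E c"
  \<comment> \<open>The sign of the quotient by the linear factors. At a zero \<open>t\<close>, this quotient extends to the
    derivative divided by the remaining factors.\<close>
  define S where "S t = (if t \<in> Z then sgn (gpoly_deriv E c t) else sgn (g t)) 
     * (\<Prod>z\<in>Z-{t}. sgn (t - z))" for t
  have der: "(g has_real_derivative gpoly_deriv E c t) (at t)" if "0 < t" for t
    using gpoly_has_derivative[OF that] by (simp add: g_def)
  have evZ: "\<forall>\<^sub>F t in at x. t \<notin> Z" for x
    using finite_set_avoid[OF \<open>finite Z\<close>, of x] unfolding eventually_at
    by (metis UNIV_I dist_commute not_le)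
  have loc: "\<forall>\<^sub>F t in at x. S x = S t" if x: "0 < x" for x
  proof (cases "x \<in> Z")
    case True
    have "\<forall>\<^sub>F t in at x. sgn (g t) = sgn (gpoly_deriv E c x) * sgn (t - x)"
      using gpoly_simple_zero[OF E card True] der[OF x] E True
      by (intro sgn_near_simple_zero) (auto simp: g_def)
    moreover have "\<forall>\<^sub>F t in at x. (\<Prod>z\<in>Z-{x}. sgn (t - z)) = (\<Prod>z\<in>Z-{x}. sgn (x - z))"
      using E by (intro prod_sgn_locally_const) auto
    moreover have "\<forall>\<^sub>F t in at x. t \<noteq> x" by (simp add: eventually_at_filter)
    ultimately show ?thesis using evZ[of x]
    proof eventually_elim
      case (elim t)
      have "(\<Prod>z\<in>Z. sgn (t - z)) = sgn (t - x) * (\<Prod>z\<in>Z-{x}. sgn (t - z))"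
        using E True by (simp add: prod.remove)
      then show ?case using elim True by (auto simp: S_def sgn_if)
    qed
  next
    case False
    \<comment> \<open>A zero outside \<open>Z\<close> would be one too many.\<close>
    have "card (insert x Z) < card E" if "g x = 0"
      using that E x by (intro gpoly_card_zeros[where c=c]) (auto simp: g_def)
    then have "g x \<noteq> 0" using card False E by auto
    then have "\<forall>\<^sub>F t in at x. sgn (g t) = sgn (g x)"
      using der[OF x] by (intro sgn_locally_const) (auto intro: DERIV_isCont)
    moreover have "\<forall>\<^sub>F t in at x. (\<Prod>z\<in>Z. sgn (t - z)) = (\<Prod>z\<in>Z. sgn (x - z))"
      using E False by (intro prod_sgn_locally_const) auto
    ultimately show ?thesis using evZ[of x]
      by eventually_elim (use False in \<open>auto simp: S_def\<close>)
  qed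
  have S: "S t = S 1" if "0 < t" for t
    using connected_local_const[of "{0<..}" t 1 S] loc that
    by (auto simp: connected_Ioi eventually_at_filter at_within_open[of _ "{0<..}"])
  show ?thesis
  proof (intro exI[of _ "S 1"] allI impI)
    fix t :: real assume t: "0 < t"
    show "sgn (gpoly E c t) = S 1 * (\<Prod>z\<in>Z. sgn (t - z))"
    proof (cases "t \<in> Z")
      case True
      then have "(\<Prod>z\<in>Z. sgn (t - z)) = 0" using E by (intro prod_zero) (auto intro!: bexI[of _ t])
      then show ?thesis using True E by simp
    next
      case False
      have "(\<Prod>z\<in>Z. sgn (t - z)) * (\<Prod>z\<in>Z. sgn (t - z)) = (\<Prod>z\<in>Z. 1)"
        unfolding prod.distrib[symmetric] using False by (intro prod.cong) (auto simp: sgn_if)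
      moreover have "S 1 = sgn (g t) * (\<Prod>z\<in>Z. sgn (t - z))"
        using S[OF t] False by (simp add: S_def)
      ultimately show ?thesis by (simp add: g_def)
    qed
  qed
qed

section \<open>Signs of the coefficients in the extremal case\<close>

lemma gpoly_sgn_at_top:
  assumes E: "finite E" "a \<in> E" "\<forall>e\<in>E. e \<le> a" "c a \<noteq> 0"
  shows "\<forall>\<^sub>F t in at_top. sgn (gpoly E c t) = sgn (c a)"
proof -
  have lim: "((\<lambda>t. \<Sum>e\<in>E. c e * t powr (e - a)) \<longlongrightarrow> (\<Sum>e\<in>E. if e = a then c a else 0)) at_top"
  proof (rule tendsto_sum)
    fix e assume "e \<in> E"
    show "((\<lambda>t. c e * t powr (e - a)) \<longlongrightarrow> (if e = a then c a else 0)) at_top"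
    proof (cases "e = a")
      case True
      have "\<forall>\<^sub>F t in at_top. c e * t powr (e - a) = c a"
        using eventually_gt_at_top[of "0::real"] by eventually_elim (use True in auto)
      then show ?thesis using True by (simp add: tendsto_eventually)
    next
      case False
      then have "e - a < 0" using E \<open>e \<in> E\<close> by force
      then have "((\<lambda>t. c e * t powr (e - a)) \<longlongrightarrow> c e * 0) at_top"
        by (intro tendsto_intros tendsto_neg_powr filterlim_ident)
      then show ?thesis using False by simp
    qed
  qed
  have "((\<lambda>t. (\<Sum>e\<in>E. c e * t powr (e - a)) * c a) \<longlongrightarrow> c a * c a) at_top"
    using tendsto_mult_right[OF lim, of "c a"] E by (simp add: sum.delta)
  then have "\<forall>\<^sub>F t in at_top. (\<Sum>e\<in>E. c e * t powr (e - a)) * c a > 0"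
    by (rule order_tendstoD) (use E in \<open>auto simp: zero_less_mult_iff\<close>)
  then show ?thesis using eventually_gt_at_top[of "0::real"]
  proof eventually_elim
    case (elim t)
    have "gpoly E c t = t powr a * (\<Sum>e\<in>E. c e * t powr (e - a))"
      unfolding gpoly_def sum_distrib_left using elim
      by (intro sum.cong) (auto simp: powr_diff)
    then have "sgn (gpoly E c t) = sgn (\<Sum>e\<in>E. c e * t powr (e - a))"
      using elim by (simp add: sgn_mult)
    then show ?case using elim by (auto simp: sgn_if zero_less_mult_iff)
  qed
qed

text \<open>
The substitution \<open>t \<mapsto> inverse t\<close> negates all exponents and reduces this to the behaviour at infinity.
\<close>

lemma gpoly_sgn_at_0:
  assumes E: "finite E" "a \<in> E" "\<forall>e\<in>E. a \<le> e" "c a \<noteq> 0"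
  shows "\<forall>\<^sub>F t in at_right 0. sgn (gpoly E c t) = sgn (c a)"
proof -
  have refl: "gpoly (uminus ` E) (\<lambda>e. c (- e)) (inverse t) = gpoly E c t" if "0 < t" for t
    using that unfolding gpoly_def
    by (subst sum.reindex) (auto intro!: sum.cong simp: powr_def ln_inverse)
  have "\<forall>\<^sub>F t in at_top. sgn (gpoly (uminus ` E) (\<lambda>e. c (- e)) t) = sgn (c a)"
    using gpoly_sgn_at_top[of "uminus ` E" "-a" "\<lambda>e. c (- e)"] E by auto
  then have "\<forall>\<^sub>F t in at_right 0. sgn (gpoly (uminus ` E) (\<lambda>e. c (- e)) (inverse t)) = sgn (c a)"
    by (rule eventually_compose_filterlim) (rule filterlim_inverse_at_top_right)
  moreover have "\<forall>\<^sub>F t::real in at_right 0. 0 < t" by (simp add: eventually_at_right_less)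
  ultimately show ?thesis by eventually_elim (use refl in auto)
qed

lemma gpoly_coeff_nonzero:
  assumes E: "finite E" "finite Z" "Z \<subseteq> {0<..}" "\<forall>z\<in>Z. gpoly E c z = 0" "\<exists>e\<in>E. c e \<noteq> 0"
    and card: "card E = Suc (card Z)" and e: "e \<in> E"
  shows "c e \<noteq> 0"
proof
  assume "c e = 0"
  then have "gpoly (E - {e}) c t = gpoly E c t" for t
    unfolding gpoly_def using E by (intro sum.mono_neutral_left) auto
  moreover have "\<exists>e\<in>E-{e}. c e \<noteq> 0" using E \<open>c e = 0\<close> by auto
  ultimately have "card Z < card (E - {e})"
    using E by (intro gpoly_card_zeros[where c=c]) auto
  then show False using card e E by simp
qed

text \<open>
The unknown constant of \<open>gpoly_sgn_const\<close> is read off at infinity, where all linear factors are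
positive and the largest exponent dominates.
\<close>

lemma gpoly_sgn_top:
  assumes E: "finite E" "finite Z" "Z \<subseteq> {0<..}" "\<forall>z\<in>Z. gpoly E c z = 0" "\<exists>e\<in>E. c e \<noteq> 0"
    and card: "card E = Suc (card Z)" and t: "0 < t"
  shows "sgn (gpoly E c t) = sgn (c (Max E)) * (\<Prod>z\<in>Z. sgn (t - z))"
proof -
  obtain s where s: "\<And>t. t > 0 \<Longrightarrow> sgn (gpoly E c t) = s * (\<Prod>z\<in>Z. sgn (t - z))"
    using gpoly_sgn_const[OF E card] by blast
  have M: "Max E \<in> E" "\<forall>e\<in>E. e \<le> Max E" using E by (auto intro!: Max_in)
  have "\<forall>\<^sub>F t in at_top. sgn (gpoly E c t) = sgn (c (Max E))"
    using gpoly_sgn_at_top[of E "Max E" c] gpoly_coeff_nonzero[OF E card M(1)] E M by auto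
  moreover have "\<forall>\<^sub>F t in at_top. \<forall>z\<in>Z. z < t"
    unfolding eventually_ball_finite_distrib[OF E(2)] by (simp add: eventually_gt_at_top)
  moreover have "\<forall>\<^sub>F t::real in at_top. 0 < t" by (simp add: eventually_gt_at_top)
  ultimately have "\<forall>\<^sub>F t::real in at_top. s = sgn (c (Max E))"
  proof eventually_elim
    case (elim t)
    then have "(\<Prod>z\<in>Z. sgn (t - z)) = 1" by (intro prod.neutral) auto
    then show ?case using s[of t] elim by simp
  qed
  then have "s = sgn (c (Max E))" by simp
  then show ?thesis using s t by simp
qed

text \<open>
Near \<open>0\<close> the smallest exponent dominates and all linear factors are negative.
\<close>

lemma gpoly_coeff_min_max:
  assumes E: "finite E" "finite Z" "Z \<subseteq> {0<..}" "\<forall>z\<in>Z. gpoly E c z = 0" "\<exists>e\<in>E. c e \<noteq> 0"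
    and card: "card E = Suc (card Z)"
  shows "sgn (c (Min E)) = sgn (c (Max E)) * (- 1) ^ card Z"
proof -
  have M: "Min E \<in> E" "\<forall>e\<in>E. Min E \<le> e" using E by (auto intro!: Min_in)
  have "\<forall>\<^sub>F t in at_right 0. sgn (gpoly E c t) = sgn (c (Min E))"
    using gpoly_sgn_at_0[of E "Min E" c] gpoly_coeff_nonzero[OF E card M(1)] E M by auto
  moreover have "\<forall>\<^sub>F t in at_right 0. \<forall>z\<in>Z. t < z"
    unfolding eventually_ball_finite_distrib[OF E(2)]
    using E(3) by (auto intro!: order_tendstoD(2)[OF tendsto_ident_at])
  moreover have "\<forall>\<^sub>F t::real in at_right 0. 0 < t" by (simp add: eventually_at_right_less)
  ultimately have "\<forall>\<^sub>F t::real in at_right 0. sgn (c (Min E)) = sgn (c (Max E)) * (- 1) ^ card Z"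
  proof eventually_elim
    case (elim t)
    then have "(\<Prod>z\<in>Z. sgn (t - z)) = (\<Prod>z\<in>Z. -1)" by (intro prod.cong) auto
    then show ?case using gpoly_sgn_top[OF E card, of t] elim by simp
  qed
  then show ?thesis by simp
qed

text \<open>
The smallest exponent is compared with the largest one by \<open>gpoly_coeff_min_max\<close>. For any other
exponent, remove the smallest term by the operator of \<open>gpoly_euler\<close>: the case remains extremal, and
the factors \<open>e - a\<close> in the new coefficients are positive.
\<close>

lemma gpoly_coeff_alternate:
  assumes E: "finite E" "finite Z" "Z \<subseteq> {0<..}" "\<forall>z\<in>Z. gpoly E c z = 0" "\<exists>e\<in>E. c e \<noteq> 0"
    and card: "card E = Suc (card Z)" and e: "e \<in> E"
  shows "sgn (c e) = sgn (c (Max E)) * (- 1) ^ card {e'\<in>E. e < e'}"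
  using assms
proof (induction "card E" arbitrary: E Z c rule: less_induct)
  case less
  note E = less.prems(1-5) and card = less.prems(6) and e = less.prems(7)
  define a where "a = Min E"
  have a: "a \<in> E" "\<forall>e\<in>E. a \<le> e" using E by (auto simp: a_def intro!: Min_in)
  show ?case
  proof (cases "e = a")
    case True
    have "{e'\<in>E. e < e'} = E - {a}" using True a by force
    then have "card {e'\<in>E. e < e'} = card Z" using a E card by simp
    then show ?thesis using gpoly_coeff_min_max[OF E card] True by (simp add: a_def)
  next
    case False
    then have ae: "a < e" using a e by force
    let ?E = "E - {a}" and ?c = "\<lambda>e. c e * (e - a)"
    obtain Z' where Z': "finite Z'" "Z' \<subseteq> {0<..}" "card Z \<le> Suc (card Z')" "Z \<inter> Z' = {}"
        "\<forall>w\<in>Z'. w * gpoly_deriv E c w = a * gpoly E c w"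
      using euler_rolle[OF E(2-4) gpoly_has_derivative, where a=a] by blast
    have zero: "\<forall>w\<in>Z'. gpoly ?E ?c w = 0"
      using gpoly_euler[of _ E c a] Z' E by force
    have "c e \<noteq> 0" using gpoly_coeff_nonzero[OF E card e] .
    then have nz: "\<exists>e\<in>?E. ?c e \<noteq> 0" using e False by (intro bexI[of _ e]) auto
    have "card Z' < card ?E"
      using gpoly_card_zeros[OF _ Z'(1,2) zero nz] E by simp
    then have card': "card ?E = Suc (card Z')" using Z'(3) card a E by simp
    have "e \<le> Max E" "Max E \<in> E" using e E by (auto intro!: Max_in)
    then have M: "Max ?E = Max E" using ae E by (intro Max_eqI) auto
    have "sgn (?c e) = sgn (?c (Max ?E)) * (- 1) ^ card {e'\<in>?E. e < e'}"
      using E e False a card card' Z' zero nz by (intro less.hyps[of ?E Z' ?c]) auto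
    moreover have "{e'\<in>?E. e < e'} = {e'\<in>E. e < e'}" using ae by auto
    ultimately show ?thesis using ae \<open>e \<le> Max E\<close> by (simp add: M sgn_mult)
  qed
qed

text \<open>
The sign of an extremal generalized polynomial in terms of any one of its coefficients. Two
such functions that share a coefficient can thus be compared, even if their leading terms are unrelated.
\<close>

lemma gpoly_sgn:
  assumes E: "finite E" "finite Z" "Z \<subseteq> {0<..}" "\<forall>z\<in>Z. gpoly E c z = 0"
    and card: "card E = Suc (card Z)" and e: "e \<in> E" "c e \<noteq> 0" and t: "0 < t"
  shows "sgn (gpoly E c t) = sgn (c e) * (- 1) ^ card {e'\<in>E. e < e'} * (\<Prod>z\<in>Z. sgn (t - z))"
proof -
  have E5: "\<exists>e\<in>E. c e \<noteq> 0" using e by auto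
  show ?thesis
    using gpoly_sgn_top[OF E E5 card t] gpoly_coeff_alternate[OF E E5 card e(1)]
    by (simp add: mult.assoc power_mult_distrib[symmetric])
qed

section \<open>Determinants as generalized polynomials in one coordinate\<close>

definition upd_coord :: "real ^ 'n \<Rightarrow> 'n \<Rightarrow> real \<Rightarrow> real ^ 'n" where
  "upd_coord u i t = (\<chi> j. if j = i then t else u $ j)"

lemma upd_coord_nth [simp]: "upd_coord u i t $ j = (if j = i then t else u $ j)"
  by (simp add: upd_coord_def)

text \<open>
The cofactor of the entry \<open>(i, k)\<close>, as a determinant of the same size: dimensions are types, and
no smaller matrix has to be formed.
\<close>

definition row_minor :: "'a::comm_ring_1 ^ 'n ^ 'n \<Rightarrow> 'n \<Rightarrow> 'n \<Rightarrow> 'a" where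
  "row_minor A i k = det (\<chi> r. if r = i then axis k 1 else A $ r)"

lemma det_row_expansion:
  fixes A :: "'a::comm_ring_1 ^ 'n ^ 'n"
  shows "det A = (\<Sum>k\<in>UNIV. A $ i $ k * row_minor A i k)"
proof -
  have "(\<Sum>k\<in>UNIV. A $ i $ k *s axis k 1) = A $ i"
    by (simp add: vec_eq_iff axis_def if_distrib cong: if_cong)
  then have "A = (\<chi> r. if r = i then (\<Sum>k\<in>UNIV. A $ i $ k *s axis k 1) else A $ r)"
    by (simp add: vec_eq_iff)
  then have "det A = det (\<chi> r. if r = i then (\<Sum>k\<in>UNIV. A $ i $ k *s axis k 1) else A $ r)"
    by (rule arg_cong)
  also have "\<dots> = (\<Sum>k\<in>UNIV. A $ i $ k * row_minor A i k)"
    by (simp add: det_linear_row_sum det_row_mul row_minor_def)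
  finally show ?thesis .
qed

text \<open>
In the Leibniz formula, the unit row forces \<open>p i = k\<close>, so no other entry of row \<open>i\<close> or column \<open>k\<close>
occurs in a nonzero product.
\<close>

lemma row_minor_cong:
  assumes "\<And>r j. r \<noteq> i \<Longrightarrow> j \<noteq> k \<Longrightarrow> A $ r $ j = B $ r $ j"
  shows "row_minor A i k = row_minor B i k"
proof -
  let ?M = "\<lambda>A. \<chi> r. if r = i then axis k 1 else A $ r"
  have "of_int (sign p) * (\<Prod>r\<in>UNIV. ?M A $ r $ p r) = of_int (sign p) * (\<Prod>r\<in>UNIV. ?M B $ r $ p r)"
    if p: "p permutes UNIV" for p
  proof (cases "p i = k")
    case True
    have "p r \<noteq> k" if "r \<noteq> i" for r using True that permutes_inj[OF p] by (metis injD)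
    then show ?thesis using assms by (intro arg_cong2[of _ _ _ _ "(*)"] prod.cong) auto
  next
    case False
    then have "?M A $ i $ p i = 0" "?M B $ i $ p i = 0" by (auto simp: axis_def)
    then have "(\<Prod>r\<in>UNIV. ?M A $ r $ p r) = 0" "(\<Prod>r\<in>UNIV. ?M B $ r $ p r) = 0"
      by (auto intro!: prod_zero exI[of _ i])
    then show ?thesis by simp
  qed
  then show ?thesis unfolding row_minor_def det_def by (intro sum.cong) auto
qed

text \<open>
Rewrites a family of coefficients indexed like \<open>m\<close> as a coefficient function on exponents that
vanishes off the entries of \<open>m\<close>, as \<open>gpoly\<close> expects.
\<close>

definition exponent_coeffs :: "real ^ 'n \<Rightarrow> ('n \<Rightarrow> real) \<Rightarrow> real \<Rightarrow> real" where
  "exponent_coeffs m C e = (\<Sum>j\<in>UNIV. if m $ j = e then C j else 0)"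

lemma exponent_coeffs_nth:
  assumes "inj (($) m)"
  shows "exponent_coeffs m C (m $ k) = C k"
  using assms unfolding exponent_coeffs_def by (simp add: inj_eq)

lemma exponent_coeffs_outside: "e \<notin> range (($) m) \<Longrightarrow> exponent_coeffs m C e = 0"
  unfolding exponent_coeffs_def by (intro sum.neutral) auto

lemma gpoly_exponent_coeffs:
  assumes "finite E" "range (($) m) \<subseteq> E"
  shows "gpoly E (exponent_coeffs m C) t = (\<Sum>j\<in>UNIV. t powr (m $ j) * C j)"
proof -
  have "gpoly E (exponent_coeffs m C) t = (\<Sum>e\<in>E. \<Sum>j\<in>UNIV. if m $ j = e then t powr (m $ j) * C j else 0)"
    unfolding gpoly_def exponent_coeffs_def sum_distrib_right
    by (intro sum.cong) auto
  also have "\<dots> = (\<Sum>j\<in>UNIV. \<Sum>e\<in>E. if m $ j = e then t powr (m $ j) * C j else 0)"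
    by (rule sum.swap)
  also have "\<dots> = (\<Sum>j\<in>UNIV. t powr (m $ j) * C j)"
    using assms by (intro sum.cong) auto
  finally show ?thesis .
qed

lemma pos_orthant_distinctD:
  assumes "u \<in> pos_orthant_distinct"
  shows "0 < u $ i" "inj (($) u)"
  using assms by (auto simp: pos_orthant_distinct_def pos_orthant_def inj_eq)

lemma strict_mono_nth_inj: "strict_mono (($) (m :: 'a::linorder ^ ('n::{finite,linorder}))) \<Longrightarrow> inj (($) m)"
  by (rule strict_mono_imp_inj_on)

text \<open>
A vector in the kernel gives the coefficients of a generalized polynomial with \<open>N\<close> terms and the \<open>N\<close>
distinct positive zeros \<open>u $ i\<close>.
\<close>

lemma det_entrywise_powr_nonzero:
  fixes m u :: "real ^ 'n"
  assumes u: "u \<in> pos_orthant_distinct" and m: "inj (($) m)"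
  shows "det (entrywise_powr u m) \<noteq> 0"
proof
  assume "det (entrywise_powr u m) = 0"
  then have "\<not> invertible (entrywise_powr u m)" by (simp add: invertible_det_nz)
  then obtain x where x: "entrywise_powr u m *v x = 0" "x \<noteq> 0"
    unfolding invertible_left_inverse matrix_left_invertible_ker by blast
  let ?c = "exponent_coeffs m (($) x)"
  have "gpoly (range (($) m)) ?c (u $ i) = (entrywise_powr u m *v x) $ i" for i
    by (subst gpoly_exponent_coeffs) (auto simp: matrix_vector_mult_def entrywise_powr_def)
  then have "\<forall>z\<in>range (($) u). gpoly (range (($) m)) ?c z = 0" using x by auto
  moreover obtain j where "x $ j \<noteq> 0" using x(2) by (auto simp: vec_eq_iff)
  then have "\<exists>e\<in>range (($) m). ?c e \<noteq> 0" using exponent_coeffs_nth[OF m] by auto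
  ultimately have "card (range (($) u)) < card (range (($) m))"
    using pos_orthant_distinctD(1)[OF u] by (intro gpoly_card_zeros[where c="?c"]) auto
  then show False
    using m pos_orthant_distinctD(2)[OF u] by (simp add: card_image)
qed

lemma det_entrywise_powr_upd:
  "det (entrywise_powr (upd_coord u i t) m)
     = (\<Sum>k\<in>UNIV. t powr (m $ k) * row_minor (entrywise_powr u m) i k)"
proof -
  have "row_minor (entrywise_powr (upd_coord u i t) m) i k = row_minor (entrywise_powr u m) i k" for k
    by (rule row_minor_cong) (simp add: entrywise_powr_def)
  then show ?thesis
    by (subst det_row_expansion[of _ i]) (simp add: entrywise_powr_def)
qed

lemma upd_coord_same [simp]: "upd_coord u i (u $ i) = u"
  by (simp add: vec_eq_iff)

lemma det_entrywise_powr_upd_zero: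
  assumes "j \<noteq> i"
  shows "det (entrywise_powr (upd_coord u i (u $ j)) m) = 0"
  using assms by (intro det_identical_rows[of i j]) (auto simp: row_def entrywise_powr_def vec_eq_iff)

lemma prod_sgn_other_coords:
  assumes "inj (($) u)"
  shows "(\<Prod>z\<in>(($) u) ` (UNIV - {i}). sgn (t - z)) = (\<Prod>j\<in>UNIV - {i}. sgn (t - u $ j))"
  using assms by (subst prod.reindex) (auto intro: inj_on_subset)

text \<open>
As a function of \<open>t\<close>, the determinant has \<open>N\<close> terms and vanishes at the \<open>N - 1\<close> other coordinates,
so \<open>gpoly_sgn\<close> applies, with the coefficient at the exponent of index \<open>k\<close>.
\<close>

lemma det_entrywise_powr_upd_sgn:
  fixes m u :: "real ^ ('n::{finite,linorder})"
  assumes u: "u \<in> pos_orthant_distinct" and m: "strict_mono (($) m)" and t: "0 < t"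
  shows "row_minor (entrywise_powr u m) i k \<noteq> 0"
    and "sgn (det (entrywise_powr (upd_coord u i t) m)) =
      sgn (row_minor (entrywise_powr u m) i k) * (-1) ^ card {j. k < j} * (\<Prod>j\<in>UNIV-{i}. sgn (t - u $ j))"
proof -
  note inju = pos_orthant_distinctD(2)[OF u] and injm = strict_mono_nth_inj[OF m]
  let ?C = "row_minor (entrywise_powr u m) i"
  let ?E = "range (($) m)" and ?Z = "(($) u) ` (UNIV - {i})" and ?c = "exponent_coeffs m ?C"
  have P: "gpoly ?E ?c t = det (entrywise_powr (upd_coord u i t) m)" for t
    by (simp add: gpoly_exponent_coeffs det_entrywise_powr_upd)
  have zero: "\<forall>z\<in>?Z. gpoly ?E ?c z = 0"
    unfolding P by (auto simp: det_entrywise_powr_upd_zero)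
  have "card ?Z = card (UNIV - {i})" using inju by (intro card_image) (auto intro: inj_on_subset)
  moreover have "card ?E = CARD('n)" using injm by (simp add: card_image)
  ultimately have card: "card ?E = Suc (card ?Z)" by simp
  have Z: "?Z \<subseteq> {0<..}" using pos_orthant_distinctD(1)[OF u] by auto
  have "gpoly ?E ?c (u $ i) \<noteq> 0"
    unfolding P using det_entrywise_powr_nonzero[OF u injm] by simp
  then have "\<exists>e\<in>?E. ?c e \<noteq> 0" unfolding gpoly_def by (auto intro: ccontr sum.neutral)
  then have "?c (m $ k) \<noteq> 0"
    using zero card Z by (intro gpoly_coeff_nonzero[of ?E ?Z]) auto
  then show C: "?C k \<noteq> 0" by (simp add: exponent_coeffs_nth[OF injm])
  have "{e'\<in>?E. m $ k < e'} = (($) m) ` {j. k < j}"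
    using m by (auto simp: strict_mono_less)
  then have "card {e'\<in>?E. m $ k < e'} = card {j. k < j}"
    using injm by (simp add: card_image inj_on_subset)
  then show "sgn (det (entrywise_powr (upd_coord u i t) m)) =
      sgn (?C k) * (-1) ^ card {j. k < j} * (\<Prod>j\<in>UNIV-{i}. sgn (t - u $ j))"
    using gpoly_sgn[OF _ _ Z zero card, of "m $ k" t] C t
    by (simp add: P exponent_coeffs_nth[OF injm] prod_sgn_other_coords[OF inju])
qed

section \<open>Monotonicity of the determinant ratio\<close>

lemma row_minor_raise_exponent:
  assumes "\<And>j. j \<noteq> k \<Longrightarrow> m $ j = n $ j"
  shows "row_minor (entrywise_powr u m) i k = row_minor (entrywise_powr u n) i k"
  using assms by (intro row_minor_cong) (simp add: entrywise_powr_def)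

lemma divide_pos_of_sgn_eq:
  fixes x y :: real
  assumes "sgn x = sgn y" "y \<noteq> 0"
  shows "0 < x / y"
proof -
  have "sgn (x / y) = 1" using assms by (simp add: sgn_divide sgn_eq_0_iff)
  then show ?thesis by (simp only: sgn_1_pos)
qed

text \<open>
Numerator and denominator are extremal generalized polynomials in a coordinate \<open>u $ i\<close> with the same zeros,
and they share the coefficient with index \<open>k\<close>.
\<close>

lemma det_ratio_raise_one_pos:
  fixes m n u :: "real ^ ('n::{finite,linorder})"
  assumes u: "u \<in> pos_orthant_distinct" and mn: "strict_mono (($) m)" "strict_mono (($) n)"
    and k: "\<And>j. j \<noteq> k \<Longrightarrow> m $ j = n $ j"
  shows "0 < det_ratio m n u"
proof -
  have "sgn (det (entrywise_powr u m)) = sgn (det (entrywise_powr u n))"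
    using det_entrywise_powr_upd_sgn(2)[OF u mn(1), of "u $ i" i k]
      det_entrywise_powr_upd_sgn(2)[OF u mn(2), of "u $ i" i k]
      row_minor_raise_exponent[OF k] pos_orthant_distinctD(1)[OF u] by simp
  moreover have "det (entrywise_powr u m) \<noteq> 0"
    using det_entrywise_powr_nonzero[OF u strict_mono_nth_inj[OF mn(1)]] .
  ultimately show ?thesis
    unfolding det_ratio_def by (auto simp: sgn_if zero_less_divide_iff split: if_splits)
qed

text \<open>
The determinants of \<open>u\<close> and \<open>v\<close> are values at \<open>s\<close> and \<open>t\<close> of the same functions \<open>Pm\<close> and \<open>Pn\<close>. The sign of
\<open>Pm s * Pn t - Pn s * Pm t\<close> is known because, in \<open>t\<close>, it is an extremal generalized polynomial with
one exponent and one zero more than \<open>Pm\<close>.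
\<close>

lemma det_ratio_raise_one_less:
  fixes m n u :: "real ^ ('n::{finite,linorder})"
  assumes u: "u \<in> pos_orthant_distinct" and v: "v \<in> pos_orthant_distinct"
    and uv: "u $ i < v $ i" "\<And>j. j \<noteq> i \<Longrightarrow> u $ j = v $ j"
    and mn: "strict_mono (($) m)" "strict_mono (($) n)"
    and k: "\<And>j. j \<noteq> k \<Longrightarrow> m $ j = n $ j" and mk: "m $ k < n $ k"
  shows "det_ratio m n u < det_ratio m n v"
proof -
  note inju = pos_orthant_distinctD(2)[OF u]
    and injm = strict_mono_nth_inj[OF mn(1)] and injn = strict_mono_nth_inj[OF mn(2)]
  define s t where "s = u $ i" and "t = v $ i"
  have st: "0 < s" "s < t" using uv pos_orthant_distinctD(1)[OF u] by (auto simp: s_def t_def)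
  have us: "upd_coord u i s = u" "upd_coord u i t = v"
    using uv by (auto simp: s_def t_def vec_eq_iff)
  define Pm Pn where "Pm x = det (entrywise_powr (upd_coord u i x) m)"
    and "Pn x = det (entrywise_powr (upd_coord u i x) n)" for x
  have Pm0: "Pm s \<noteq> 0" "Pm t \<noteq> 0"
    unfolding Pm_def us using det_entrywise_powr_nonzero[OF _ injm] u v by simp_all
  define cm cn where "cm = exponent_coeffs m (row_minor (entrywise_powr u m) i)"
    and "cn = exponent_coeffs n (row_minor (entrywise_powr u n) i)"
  let ?C = "row_minor (entrywise_powr u m) i k"
  \<comment> \<open>The generalized polynomial \<open>\<lambda>x. Pm s * Pn x - Pn s * Pm x\<close>. Its exponents are those of \<open>n\<close> and one more,
    as \<open>m\<close> and \<open>n\<close> agree off \<open>k\<close>.\<close>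
  define E where "E = insert (m $ k) (range (($) n))"
  define c where "c e = Pm s * cn e - Pn s * cm e" for e
  define Z where "Z = (($) u) ` (UNIV - {i})"
  have mk_notin: "m $ k \<notin> range (($) n)"
  proof
    assume "m $ k \<in> range (($) n)"
    then obtain j where j: "m $ k = n $ j" by auto
    then show False using mk k[of j] injD[OF injm, of k j] by (cases "j = k") auto
  qed
  have nk_notin: "n $ k \<notin> range (($) m)"
  proof
    assume "n $ k \<in> range (($) m)"
    then obtain j where j: "n $ k = m $ j" by auto
    then show False using mk k[of j] injD[OF injn, of k j] by (cases "j = k") auto
  qed
  have E: "finite E" "range (($) m) \<subseteq> E" "range (($) n) \<subseteq> E"
    using k by (auto simp: E_def) (metis rangeI)
  have phi: "gpoly E c x = Pm s * Pn x - Pn s * Pm x" for x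
  proof -
    have "gpoly E c x = Pm s * gpoly E cn x - Pn s * gpoly E cm x"
      unfolding gpoly_def c_def
      by (simp add: sum_distrib_left sum_subtractf[symmetric] algebra_simps)
    then show ?thesis
      by (simp add: cm_def cn_def gpoly_exponent_coeffs E Pm_def Pn_def det_entrywise_powr_upd)
  qed
  have "s \<notin> Z" using inju by (auto simp: s_def Z_def inj_eq)
  have "card Z = card (UNIV - {i})"
    unfolding Z_def using inju by (intro card_image) (auto intro: inj_on_subset)
  then have card: "card E = Suc (card (insert s Z))"
    using mk_notin injn \<open>s \<notin> Z\<close> by (simp add: E_def card_image Z_def)
  have "\<forall>z\<in>Z. gpoly E c z = 0"
    unfolding phi by (auto simp: Pm_def Pn_def Z_def det_entrywise_powr_upd_zero)
  then have zero: "\<forall>z\<in>insert s Z. gpoly E c z = 0" by (simp add: phi)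
  have Zpos: "insert s Z \<subseteq> {0<..}"
    using pos_orthant_distinctD(1)[OF u] by (auto simp: Z_def s_def)
  have cnk: "c (n $ k) = Pm s * ?C"
    using nk_notin row_minor_raise_exponent[OF k, where u=u and i=i]
    by (simp add: c_def cn_def cm_def exponent_coeffs_nth[OF injn] exponent_coeffs_outside)
  have C0: "?C \<noteq> 0" using det_entrywise_powr_upd_sgn(1)[OF u mn(1) st(1)] .
  \<comment> \<open>The additional exponent \<open>m $ k\<close> lies below \<open>n $ k\<close>, so the power of
    \<open>-1\<close> is the same as for \<open>Pm\<close> and cancels below.\<close>
  have "{e\<in>E. n $ k < e} = (($) n) ` {j. k < j}"
    using mk mn(2) by (auto simp: E_def strict_mono_less)
  then have "card {e\<in>E. n $ k < e} = card {j. k < j}"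
    using injn by (simp add: card_image inj_on_subset)
  then have "sgn (gpoly E c t) = sgn (Pm s) * sgn ?C * (-1) ^ card {j. k < j} * 
       (\<Prod>z\<in>insert s Z. sgn (t - z))"
    using gpoly_sgn[OF E(1) _ Zpos zero card, of "n $ k" t] cnk C0 Pm0 st
    by (simp add: E_def sgn_mult Z_def)
  also have "(\<Prod>z\<in>insert s Z. sgn (t - z)) = (\<Prod>j\<in>UNIV-{i}. sgn (t - u $ j))"
    using \<open>s \<notin> Z\<close> st prod_sgn_other_coords[OF inju, of t i] by (simp add: Z_def)
  also have "sgn (Pm s) * sgn ?C * (-1) ^ card {j. k < j} * (\<Prod>j\<in>UNIV-{i}. sgn (t - u $ j))
      = sgn (Pm s * Pm t)"
    using det_entrywise_powr_upd_sgn(2)[OF u mn(1), of t i k] st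
    by (simp add: Pm_def sgn_mult)
  finally have "sgn (Pm s * Pn t - Pn s * Pm t) = sgn (Pm s * Pm t)" by (simp add: phi)
  then have "0 < (Pm s * Pn t - Pn s * Pm t) / (Pm s * Pm t)"
    using Pm0 by (intro divide_pos_of_sgn_eq) auto
  also have "\<dots> = det_ratio m n v - det_ratio m n u"
  proof -
    have "det_ratio m n u = Pn s / Pm s" "det_ratio m n v = Pn t / Pm t"
      by (simp_all only: det_ratio_def Pm_def Pn_def us)
    then show ?thesis using Pm0 by (simp add: diff_divide_distrib)
  qed
  finally show ?thesis by simp
qed

text \<open>
From \<open>m\<close>, one reaches \<open>n\<close> through strictly increasing exponent tuples by raising single entries.
The largest index \<open>k\<close> at which \<open>m\<close> differs from \<open>n\<close> comes first: the entries above it have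
their final values, which exceed \<open>n $ k\<close>.
\<close>

lemma raise_exponents_induct [consumes 3, case_names refl step]:
  fixes m n :: "real ^ ('n::{finite,linorder})"
  assumes "strict_mono (($) m)" "strict_mono (($) n)" "\<And>j. m $ j \<le> n $ j"
    and refl: "P n"
    and step: "\<And>m k t. strict_mono (($) m) \<Longrightarrow> strict_mono (($) (upd_coord m k t)) \<Longrightarrow> m $ k < t \<Longrightarrow>
      P (upd_coord m k t) \<Longrightarrow> P m"
  shows "P m"
  using assms(1-3)
proof (induction "card {j. m $ j \<noteq> n $ j}" arbitrary: m rule: less_induct)
  case less
  show ?case
  proof (cases "m = n")
    case True
    then show ?thesis using refl by simp
  next
    case False
    let ?D = "{j. m $ j \<noteq> n $ j}"
    define k where "k = Max ?D"
    have "?D \<noteq> {}" using False by (auto simp: vec_eq_iff)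
    then have "k \<in> ?D" unfolding k_def by (intro Max_in) auto
    then have mk: "m $ k < n $ k" using less.prems(3)[of k] by auto
    have above: "m $ j = n $ j" if "k < j" for j
      using Max_ge[of ?D j] that by (fastforce simp: k_def)
    have mono: "strict_mono (($) (upd_coord m k (n $ k)))"
    proof (rule strict_monoI)
      fix a b :: 'n assume ab: "a < b"
      show "upd_coord m k (n $ k) $ a < upd_coord m k (n $ k) $ b"
        using strict_monoD[OF less.prems(1) ab] strict_monoD[OF less.prems(2) ab] mk above[of b] ab
        by auto
    qed
    have "{j. upd_coord m k (n $ k) $ j \<noteq> n $ j} = ?D - {k}" by auto
    then have "card {j. upd_coord m k (n $ k) $ j \<noteq> n $ j} < card ?D"
      using card_Diff1_less[of ?D k] \<open>k \<in> ?D\<close> by simp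
    then have "P (upd_coord m k (n $ k))"
      using less.hyps[of "upd_coord m k (n $ k)"] mono less.prems by auto
    then show ?thesis using step[OF less.prems(1) mono mk] by simp
  qed
qed

lemma det_ratio_self:
  fixes n u :: "real ^ ('n::{finite,linorder})"
  assumes "strict_mono (($) n)" "u \<in> pos_orthant_distinct"
  shows "det_ratio n n u = 1"
  using det_entrywise_powr_nonzero[OF assms(2) strict_mono_nth_inj[OF assms(1)]]
  by (simp add: det_ratio_def)

lemma det_ratio_compose:
  fixes m n p u :: "real ^ ('n::{finite,linorder})"
  assumes "strict_mono (($) p)" "u \<in> pos_orthant_distinct"
  shows "det_ratio m n u = det_ratio m p u * det_ratio p n u"
  using det_entrywise_powr_nonzero[OF assms(2) strict_mono_nth_inj[OF assms(1)]]
  by (simp add: det_ratio_def)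

lemma det_ratio_pos:
  fixes m n u :: "real ^ ('n::{finite,linorder})"
  assumes "strict_mono (($) m)" "strict_mono (($) n)" "\<And>j. m $ j \<le> n $ j"
    and u: "u \<in> pos_orthant_distinct"
  shows "0 < det_ratio m n u"
  using assms(1-3)
proof (induction m rule: raise_exponents_induct)
  case refl
  show ?case using det_ratio_self[OF assms(2) u] by simp
next
  case (step m k t)
  have "0 < det_ratio m (upd_coord m k t) u"
    using step by (intro det_ratio_raise_one_pos[OF u, where k=k]) auto
  then show ?case using step det_ratio_compose[OF step.hyps(2) u, of m n] by simp
qed

text \<open>
Induction along \<open>raise_exponents_induct\<close>. Positivity is carried along, since increasing factors
have an increasing product when they are positive.
\<close>

lemma det_ratio_less_or_eq:
  fixes m n u :: "real ^ ('n::{finite,linorder})"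
  assumes "strict_mono (($) m)" "strict_mono (($) n)" "\<And>j. m $ j \<le> n $ j"
    and u: "u \<in> pos_orthant_distinct" and v: "v \<in> pos_orthant_distinct"
    and uv: "u $ i < v $ i" "\<And>j. j \<noteq> i \<Longrightarrow> u $ j = v $ j"
  shows "m = n \<or> 0 < det_ratio m n u \<and> det_ratio m n u < det_ratio m n v"
  using assms(1-3)
proof (induction m rule: raise_exponents_induct)
  case refl
  show ?case by simp
next
  case (step m k t)
  let ?m = "upd_coord m k t"
  have "0 < det_ratio m ?m u" "det_ratio m ?m u < det_ratio m ?m v"
    using step det_ratio_raise_one_pos[OF u step.hyps(1,2), of k]
      det_ratio_raise_one_less[OF u v uv step.hyps(1,2), of k] by auto
  moreover have "0 < det_ratio ?m n u" "det_ratio ?m n u \<le> det_ratio ?m n v"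
    using step.IH det_ratio_self[OF assms(2) u] det_ratio_self[OF assms(2) v] by auto
  ultimately have "det_ratio m ?m u * det_ratio ?m n u < det_ratio m ?m v * det_ratio ?m n v"
    and "0 < det_ratio m ?m u * det_ratio ?m n u"
    by (auto intro: mult_less_le_imp_less)
  then show ?case
    unfolding det_ratio_compose[OF step.hyps(2) u, of m n] det_ratio_compose[OF step.hyps(2) v, of m n] by simp
qed

lemma det_ratio_symmetric:
  fixes m n :: "real ^ 'n"
  shows "symmetric_on pos_orthant_distinct (det_ratio m n)"
  unfolding symmetric_on_def
proof (intro ballI allI impI)
  fix u :: "real ^ 'n" and p :: "'n \<Rightarrow> 'n"
  assume p: "p permutes UNIV"
  have "det (entrywise_powr (\<chi> i. u $ p i) w) = of_int (sign p) * det (entrywise_powr u w)" for w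
    using det_permute_rows[OF p, of "entrywise_powr u w"] by (simp add: entrywise_powr_def)
  then show "det_ratio m n (\<chi> i. u $ p i) = det_ratio m n u"
    by (simp add: det_ratio_def sign_def)
qed

section \<open>Divisibility of polynomial functions and density of distinct tuples\<close>

lemma real_polynomial_function_nth: "real_polynomial_function (\<lambda>u :: real ^ 'n. u $ i)"
  by (rule real_polynomial_function.intros(1)) (rule bounded_linear_vec_nth)

lemma continuous_on_real_polynomial_function:
  "real_polynomial_function p \<Longrightarrow> continuous_on S p"
  by (intro continuous_at_imp_continuous_on ballI continuous_real_polymonial_function)

text \<open>
The factor theorem for \<open>u $ i - u $ j\<close>, by structural induction; products are handled as in the
product rule for difference quotients.
\<close>

lemma real_polynomial_function_coord_quotient:
  fixes p :: "real ^ 'n \<Rightarrow> real"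
  assumes "real_polynomial_function p"
  shows "\<exists>r. real_polynomial_function r \<and> (\<forall>u. p u - p (upd_coord u i (u $ j)) = (u $ i - u $ j) * r u)"
  using assms
proof (induction p rule: real_polynomial_function.induct)
  case (linear f)
  interpret bounded_linear f by fact
  have "u - upd_coord u i (u $ j) = (u $ i - u $ j) *\<^sub>R axis i 1" for u :: "real ^ 'n"
    by (simp add: vec_eq_iff axis_def)
  then have "f u - f (upd_coord u i (u $ j)) = (u $ i - u $ j) * f (axis i 1)" for u
    by (metis diff real_scaleR_def scale)
  then show ?case by (intro exI[of _ "\<lambda>_. f (axis i 1)"]) (auto intro: real_polynomial_function.intros(2-4))
next
  case (const c)
  then show ?case by (intro exI[of _ "\<lambda>_. 0"]) (auto intro: real_polynomial_function.intros(2-4))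
next
  case (add f g)
  then obtain r s where rs: "real_polynomial_function r" "real_polynomial_function s"
    and eq: "\<And>u. f u - f (upd_coord u i (u $ j)) = (u $ i - u $ j) * r u"
      "\<And>u. g u - g (upd_coord u i (u $ j)) = (u $ i - u $ j) * s u" by blast
  have "f u + g u - (f (upd_coord u i (u $ j)) + g (upd_coord u i (u $ j))) =
      (u $ i - u $ j) * (r u + s u)" for u
    unfolding distrib_left eq[symmetric] by simp
  then show ?case
    using real_polynomial_function.intros(3)[OF rs] by blast
next
  case (mult f g)
  then obtain r s where r: "real_polynomial_function r" and s: "real_polynomial_function s"
    and fr: "\<And>u. f u - f (upd_coord u i (u $ j)) = (u $ i - u $ j) * r u"
    and gs: "\<And>u. g u - g (upd_coord u i (u $ j)) = (u $ i - u $ j) * s u" by blast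
  have eq: "f u * g u - f (upd_coord u i (u $ j)) * g (upd_coord u i (u $ j)) =
      (u $ i - u $ j) * (r u * g u + (f u - (u $ i - u $ j) * r u) * s u)" for u
  proof -
    have f': "f (upd_coord u i (u $ j)) = f u - (u $ i - u $ j) * r u"
      and g': "g (upd_coord u i (u $ j)) = g u - (u $ i - u $ j) * s u"
      using fr[of u] gs[of u] by linarith+
    show ?thesis unfolding f' g' by algebra
  qed
  have "real_polynomial_function (\<lambda>u. r u * g u + (f u - (u $ i - u $ j) * r u) * s u)"
    using mult.hyps r s
    by (intro real_polynomial_function.intros(2-4) real_polynomial_function_diff
        real_polynomial_function_nth) auto
  then show ?case using eq by blast
qed

text \<open>
Coordinates of \<open>u\<close> that coincide are separated by the direction \<open>d\<close> at once, and those that differ stay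
different for a short time. The lemma is stated for pairs of coordinates, as a direction may also be
chosen to keep a coincidence.
\<close>

lemma eventually_distinct_coords:
  fixes u d :: "real ^ 'n"
  shows "\<forall>\<^sub>F e in at_right 0. \<forall>i j. d $ i \<noteq> d $ j \<longrightarrow> (u + e *\<^sub>R d) $ i \<noteq> (u + e *\<^sub>R d) $ j"
proof (intro eventually_all_finite)
  fix i j
  show "\<forall>\<^sub>F e in at_right 0. d $ i \<noteq> d $ j \<longrightarrow> (u + e *\<^sub>R d) $ i \<noteq> (u + e *\<^sub>R d) $ j"
  proof (cases "u $ i = u $ j")
    case True
    have "\<forall>\<^sub>F e::real in at_right 0. 0 < e" by (simp add: eventually_at_right_less)
    then show ?thesis by eventually_elim (use True in auto)
  next
    case False
    have "((\<lambda>e. (u + e *\<^sub>R d) $ i - (u + e *\<^sub>R d) $ j) \<longlongrightarrow> (u + 0 *\<^sub>R d) $ i - (u + 0 *\<^sub>R d) $ j) (at_right 0)"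
      by (intro tendsto_intros)
    then have "\<forall>\<^sub>F e in at_right 0. (u + e *\<^sub>R d) $ i - (u + e *\<^sub>R d) $ j \<noteq> 0"
      by (rule tendsto_imp_eventually_ne) (use False in auto)
    then show ?thesis by eventually_elim auto
  qed
qed

lemma tendsto_along_direction:
  fixes u d :: "'a::real_normed_vector" and f :: "'a \<Rightarrow> 'b::topological_space"
  assumes "continuous_on S f" "u \<in> S" "\<And>e. 0 < e \<Longrightarrow> u + e *\<^sub>R d \<in> S"
  shows "((\<lambda>e. f (u + e *\<^sub>R d)) \<longlongrightarrow> f u) (at_right 0)"
proof -
  have "((\<lambda>e. u + e *\<^sub>R d) \<longlongrightarrow> u + 0 *\<^sub>R d) (at_right 0)" by (intro tendsto_intros)
  then have "((\<lambda>e. u + e *\<^sub>R d) \<longlongrightarrow> u) (at_right 0)" by simp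
  moreover have "\<forall>\<^sub>F e::real in at_right 0. 0 < e" by (simp add: eventually_at_right_less)
  then have "\<forall>\<^sub>F e in at_right 0. u + e *\<^sub>R d \<in> S" by eventually_elim (rule assms(3))
  ultimately show ?thesis using assms(1,2) by (intro continuous_on_tendsto_compose[OF assms(1)])
qed

definition position :: "'n::{finite,linorder} \<Rightarrow> nat" where
  "position j = card {k. k < j}"

lemma strict_mono_position: "strict_mono position"
  unfolding position_def by (rule strict_monoI) (auto intro!: psubset_card_mono)

text \<open>
The direction in which tuples are perturbed: moving along it keeps a tuple positive and separates
all coincident coordinates.
\<close>

definition position_vec :: "real ^ ('n::{finite,linorder})" where
  "position_vec = (\<chi> j. real (Suc (position j)))"

lemma inj_position_vec: "inj (($) position_vec)"
  using strict_mono_imp_inj_on[OF strict_mono_position] by (auto simp: position_vec_def inj_def)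

lemma position_vec_pos: "0 < position_vec $ i"
  by (simp add: position_vec_def)

lemma eventually_inj_position_vec:
  fixes u :: "real ^ ('n::{finite,linorder})"
  shows "\<forall>\<^sub>F e in at_right 0. inj (($) (u + e *\<^sub>R position_vec))"
  using eventually_distinct_coords[of position_vec u]
  by eventually_elim (use inj_position_vec in \<open>auto simp: inj_def\<close>)

lemma pos_orthant_position_vec:
  assumes "u \<in> pos_orthant" "0 < e"
  shows "u + e *\<^sub>R position_vec \<in> pos_orthant"
  using assms position_vec_pos by (auto simp: pos_orthant_def intro!: add_pos_pos mult_pos_pos)

lemma eventually_pos_orthant_distinct:
  fixes u :: "real ^ ('n::{finite,linorder})"
  assumes "u \<in> pos_orthant"
  shows "\<forall>\<^sub>F e in at_right 0. u + e *\<^sub>R position_vec \<in> pos_orthant_distinct"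
proof -
  have "\<forall>\<^sub>F e::real in at_right 0. 0 < e" by (simp add: eventually_at_right_less)
  with eventually_inj_position_vec[of u] show ?thesis
    by eventually_elim (auto simp: pos_orthant_distinct_def pos_orthant_position_vec[OF assms])
qed

lemma continuous_eq_on_distinct:
  fixes f g :: "real ^ ('n::{finite,linorder}) \<Rightarrow> real"
  assumes f: "continuous_on UNIV f" and g: "continuous_on UNIV g" and eq: "\<And>u. inj (($) u) \<Longrightarrow> f u = g u"
  shows "f u = g u"
proof (rule tendsto_unique)
  show "((\<lambda>e. f (u + e *\<^sub>R position_vec)) \<longlongrightarrow> f u) (at_right 0)"
    by (rule tendsto_along_direction[OF f]) auto
  have "((\<lambda>e. g (u + e *\<^sub>R position_vec)) \<longlongrightarrow> g u) (at_right 0)"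
    by (rule tendsto_along_direction[OF g]) auto
  then show "((\<lambda>e. f (u + e *\<^sub>R position_vec)) \<longlongrightarrow> g u) (at_right 0)"
    by (rule Lim_transform_eventually)
      (use eventually_inj_position_vec[of u] in \<open>eventually_elim, simp add: eq\<close>)
qed simp

lemma continuous_eq_on_pos_orthant_distinct:
  fixes f g :: "real ^ ('n::{finite,linorder}) \<Rightarrow> real"
  assumes f: "continuous_on pos_orthant f" and g: "continuous_on pos_orthant g"
    and eq: "\<And>u. u \<in> pos_orthant_distinct \<Longrightarrow> f u = g u" and u: "u \<in> pos_orthant"
  shows "f u = g u"
proof (rule tendsto_unique)
  show "((\<lambda>e. f (u + e *\<^sub>R position_vec)) \<longlongrightarrow> f u) (at_right 0)"
    by (rule tendsto_along_direction[OF f u]) (rule pos_orthant_position_vec[OF u])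
  have "((\<lambda>e. g (u + e *\<^sub>R position_vec)) \<longlongrightarrow> g u) (at_right 0)"
    by (rule tendsto_along_direction[OF g u]) (rule pos_orthant_position_vec[OF u])
  then show "((\<lambda>e. f (u + e *\<^sub>R position_vec)) \<longlongrightarrow> g u) (at_right 0)"
    by (rule Lim_transform_eventually)
      (use eventually_pos_orthant_distinct[OF u] in \<open>eventually_elim, simp add: eq\<close>)
qed simp

section \<open>Alternants and Schur polynomials\<close>

definition alternant :: "nat ^ 'n \<Rightarrow> real ^ 'n \<Rightarrow> real" where
  "alternant a u = det (\<chi> i j. u $ i ^ (a $ j))"

lemma real_polynomial_function_alternant: "real_polynomial_function (alternant a)"
  unfolding alternant_def det_def
  by (intro real_polynomial_function_sum real_polynomial_function.intros(2-4)
      real_polynomial_function_prod)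
    (auto intro!: real_polynomial_function_power real_polynomial_function_nth)

lemma alternant_eq_0:
  assumes "i \<noteq> j" "u $ i = u $ j"
  shows "alternant a u = 0"
  unfolding alternant_def using assms by (intro det_identical_rows[of i j]) (auto simp: row_def vec_eq_iff)

text \<open>
The differences are split off one at a time. The quotient still vanishes on the next
hyperplane \<open>u $ i = u $ j\<close>: a point of it is the limit of points of the hyperplane at which the factors
split off before are nonzero.
\<close>

lemma alternant_divisible:
  fixes a :: "nat ^ ('n::{finite,linorder})"
  assumes "finite S" "S \<subseteq> {(i, j). i < j}"
  shows "\<exists>p. real_polynomial_function p \<and> (\<forall>u. alternant a u = (\<Prod>(i,j)\<in>S. u $ i - u $ j) * p u)"
  using assms
proof (induction S rule: finite_induct)
  case empty
  then show ?case using real_polynomial_function_alternant[of a] by auto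
next
  case (insert x S)
  obtain i j where x: "x = (i, j)" and ij: "i < j" using insert.prems by auto
  obtain p where p: "real_polynomial_function p"
    and eq: "\<And>u. alternant a u = (\<Prod>(i,j)\<in>S. u $ i - u $ j) * p u" using insert by auto
  have vanish: "p u = 0" if u: "u $ i = u $ j" for u
  proof -
    \<comment> \<open>A direction that separates every pair of coordinates except \<open>i\<close> and \<open>j\<close>.\<close>
    define d :: "real ^ ('n::{finite,linorder})" where "d = upd_coord position_vec i (position_vec $ j)"
    have d: "d $ k \<noteq> d $ l" if "k \<noteq> l" "{k, l} \<noteq> {i, j}" for k l
      using that injD[OF inj_position_vec, of k l] injD[OF inj_position_vec, of j l] injD[OF inj_position_vec, of k j]
      by (auto simp: d_def)
    \<comment> \<open>Along this direction the alternant is zero and the factors over \<open>S\<close> are not.\<close>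
    have "\<forall>\<^sub>F e in at_right 0. p (u + e *\<^sub>R d) = 0"
      using eventually_distinct_coords[of d u]
    proof eventually_elim
      case (elim e)
      let ?w = "u + e *\<^sub>R d"
      have "?w $ k - ?w $ l \<noteq> 0" if "(k, l) \<in> S" for k l
      proof -
        have "k < l" using insert.prems that by auto
        moreover have "(k, l) \<noteq> (i, j)" using insert.hyps that x by auto
        ultimately have "{k, l} \<noteq> {i, j}" using ij by (auto simp: doubleton_eq_iff)
        then have "d $ k \<noteq> d $ l" using d \<open>k < l\<close> by auto
        then show ?thesis using elim by simp
      qed
      then have "(\<Prod>(k,l)\<in>S. ?w $ k - ?w $ l) \<noteq> 0"
        using insert.hyps by (auto simp: prod_zero_iff)
      moreover have "?w $ i = ?w $ j" using u ij by (auto simp: d_def)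
      then have "alternant a ?w = 0" using ij by (intro alternant_eq_0[of i j]) auto
      ultimately show ?case using eq[of ?w] by simp
    qed
    then have "((\<lambda>e. p (u + e *\<^sub>R d)) \<longlongrightarrow> 0) (at_right 0)" by (rule tendsto_eventually)
    moreover have "((\<lambda>e. p (u + e *\<^sub>R d)) \<longlongrightarrow> p u) (at_right 0)"
      by (rule tendsto_along_direction[OF continuous_on_real_polynomial_function[OF p], where S=UNIV]) auto
    ultimately show ?thesis by (intro tendsto_unique[of "at_right (0::real)" "\<lambda>e. p (u + e *\<^sub>R d)"]) auto
  qed
  obtain r where r: "real_polynomial_function r"
    "\<And>u. p u - p (upd_coord u i (u $ j)) = (u $ i - u $ j) * r u"
    using real_polynomial_function_coord_quotient[OF p] by blast
  have "p u = (u $ i - u $ j) * r u" for u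
    using r(2)[of u] vanish[of "upd_coord u i (u $ j)"] ij by simp
  then have "alternant a u = (\<Prod>(i,j)\<in>insert x S. u $ i - u $ j) * r u" for u
    using eq[of u] insert.hyps by (simp add: x mult_ac)
  then show ?case using r(1) by blast
qed

definition diff_prod :: "real ^ ('n::{finite,linorder}) \<Rightarrow> real" where
  "diff_prod u = (\<Prod>(i,j)\<in>{(i,j). i < j}. u $ i - u $ j)"

lemma diff_prod_nonzero: "inj (($) u) \<Longrightarrow> diff_prod u \<noteq> 0"
  by (auto simp: diff_prod_def prod_zero_iff dest: injD)

text \<open>
The exponents \<open>0, \<dots>, N - 1\<close> of the Vandermonde determinant.
\<close>

definition staircase :: "nat ^ ('n::{finite,linorder})" where
  "staircase = (\<chi> j. position j)"

lemma sum_position: "(\<Sum>j\<in>(UNIV :: 'n set). position j) = card {(i :: 'n::{finite,linorder}, j). i < j}"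
proof -
  have "{(i :: 'n, j). i < j} = prod.swap ` (SIGMA j:UNIV. {i. i < j})" by force
  then have "card {(i :: 'n, j). i < j} = card (SIGMA j:(UNIV::'n set). {i. i < j})"
    by (simp add: card_image)
  then show ?thesis by (simp only: position_def card_SigmaI finite ball_UNIV simp_thms)
qed

lemma alternant_scale:
  "alternant a (c *\<^sub>R u) = c ^ (\<Sum>j\<in>UNIV. a $ j) * alternant a u"
proof -
  have "(\<Prod>i\<in>UNIV. (c * u $ i) ^ (a $ p i)) = c ^ (\<Sum>j\<in>UNIV. a $ j) * (\<Prod>i\<in>UNIV. u $ i ^ (a $ p i))"
    if "p permutes UNIV" for p
  proof -
    have "(\<Sum>i\<in>UNIV. a $ p i) = (\<Sum>j\<in>UNIV. a $ j)"
      using sum.permute[OF that, of "($) a"] by (simp add: o_def)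
    then have "c ^ (\<Sum>j\<in>UNIV. a $ j) = (\<Prod>i\<in>UNIV. c ^ (a $ p i))"
      by (simp only: power_sum[symmetric])
    then show ?thesis by (simp only: power_mult_distrib prod.distrib)
  qed
  then show ?thesis
    unfolding alternant_def det_def by (simp add: sum_distrib_left mult_ac)
qed

lemma alternant_eq_det_powr:
  assumes "u \<in> pos_orthant"
  shows "alternant a u = det (entrywise_powr u (\<chi> j. real (a $ j)))"
  using assms by (simp add: alternant_def entrywise_powr_def pos_orthant_def powr_realpow)

lemma position_vec_pos_orthant_distinct: "position_vec \<in> pos_orthant_distinct"
  by (simp add: pos_orthant_distinct_def pos_orthant_def inj_position_vec position_vec_pos)

lemma position_vec_pos_orthant: "position_vec \<in> pos_orthant"
  by (simp add: pos_orthant_def position_vec_pos)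

text \<open>
Both sides are homogeneous of the same degree (\<open>sum_position\<close>, \<open>alternant_scale\<close>), so the quotient is
constant along rays, and by continuity at the origin it is one constant. That constant is nonzero
because the determinant is nonzero somewhere.
\<close>

lemma vandermonde:
  "\<exists>\<kappa>. \<kappa> \<noteq> 0 \<and> (\<forall>u :: real ^ ('n::{finite,linorder}). alternant staircase u = \<kappa> * diff_prod u)"
proof -
  obtain p where p: "real_polynomial_function p"
    and eq: "\<And>u :: real ^ ('n::{finite,linorder}). alternant staircase u = diff_prod u * p u"
    using alternant_divisible[of "{(i, j). i < j}" staircase] unfolding diff_prod_def by auto
  have const: "p u = p 0" if u: "inj (($) u)" for u
  proof -
    have scale: "p (c *\<^sub>R u) = p u" if c: "0 < c" for c
    proof -
      have "(\<Prod>(i,j)\<in>{(i,j). i < j}. c * u $ i - c * u $ j) = (\<Prod>(i,j)\<in>{(i,j). i < j}. c * (u $ i - u $ j))"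
        by (simp add: algebra_simps)
      also have "\<dots> = c ^ card {(i :: 'n, j). i < j} * diff_prod u"
        by (simp add: diff_prod_def case_prod_beta prod.distrib)
      finally have "diff_prod (c *\<^sub>R u) = c ^ card {(i :: 'n, j). i < j} * diff_prod u"
        by (simp add: diff_prod_def)
      moreover have "alternant staircase (c *\<^sub>R u) = c ^ card {(i :: 'n, j). i < j} * alternant staircase u"
        by (simp add: alternant_scale staircase_def sum_position)
      ultimately show ?thesis using eq[of u] eq[of "c *\<^sub>R u"] diff_prod_nonzero[OF u] c by simp
    qed
    have "((\<lambda>e. p (0 + e *\<^sub>R u)) \<longlongrightarrow> p 0) (at_right 0)"
      by (rule tendsto_along_direction[OF continuous_on_real_polynomial_function[OF p], where S=UNIV]) auto
    moreover have "\<forall>\<^sub>F e in at_right 0. p (0 + e *\<^sub>R u) = p u"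
      using eventually_at_right_less[of "0::real"] by eventually_elim (simp add: scale)
    then have "((\<lambda>e. p (0 + e *\<^sub>R u)) \<longlongrightarrow> p u) (at_right 0)" by (rule tendsto_eventually)
    ultimately show ?thesis by (intro tendsto_unique[of "at_right (0::real)" "\<lambda>e. p (0 + e *\<^sub>R u)"]) auto
  qed
  have "alternant staircase (position_vec :: real ^ ('n::{finite,linorder})) \<noteq> 0"
  proof -
    have "inj (($) (\<chi> j. real (staircase $ j)) :: 'n \<Rightarrow> real)"
      using strict_mono_imp_inj_on[OF strict_mono_position] by (auto simp: staircase_def inj_def)
    then show ?thesis
      using det_entrywise_powr_nonzero[OF position_vec_pos_orthant_distinct]
      by (simp add: alternant_eq_det_powr position_vec_pos_orthant)
  qed
  then have "p 0 \<noteq> 0" using eq[of position_vec] const[OF inj_position_vec] by simp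
  moreover have "alternant staircase u = p 0 * diff_prod u" for u :: "real ^ ('n::{finite,linorder})"
  proof (cases "inj (($) u)")
    case True
    then show ?thesis using eq[of u] const by simp
  next
    case False
    then obtain i j where ij: "i \<noteq> j" "u $ i = u $ j" by (auto simp: inj_def)
    then have "\<exists>x\<in>{(i, j). i < j}. (case x of (i, j) \<Rightarrow> u $ i - u $ j) = 0"
      by (cases "i < j") (force simp: neq_iff)+
    then have "diff_prod u = 0" unfolding diff_prod_def by (intro prod_zero) auto
    then show ?thesis using eq[of u] by simp
  qed
  ultimately show ?thesis by blast
qed

lemma alternant_staircase_nonzero: "inj (($) u) \<Longrightarrow> alternant staircase u \<noteq> 0"
  using vandermonde diff_prod_nonzero by (metis mult_eq_0_iff)

lemma schur_altdef:
  "schur a = (THE p. real_polynomial_function p \<and>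
     (\<forall>u. inj (($) u) \<longrightarrow> p u = alternant a u / alternant staircase u))"
  by (simp add: schur_def alternant_def staircase_def position_def)

text \<open>
The description in \<open>schur\<close> does determine a polynomial function: existence comes from the divisibility of
the alternant, uniqueness from the density of tuples with distinct entries.
\<close>

lemma schur_spec:
  fixes a :: "nat ^ ('n::{finite,linorder})"
  shows "real_polynomial_function (schur a) \<and>
     (\<forall>u. inj (($) u) \<longrightarrow> schur a u = alternant a u / alternant staircase u)"
proof -
  obtain \<kappa> where \<kappa>: "\<kappa> \<noteq> 0" "\<And>u :: real ^ ('n::{finite,linorder}). alternant staircase u = \<kappa> * diff_prod u"
    using vandermonde by blast
  obtain p where p: "real_polynomial_function p" "\<And>u. alternant a u = diff_prod u * p u"
    using alternant_divisible[of "{(i, j). i < j}" a] unfolding diff_prod_def by auto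
  define q where "q u = inverse \<kappa> * p u" for u
  have q: "real_polynomial_function q"
    unfolding q_def by (intro real_polynomial_function.intros(2-4) p(1))
  have q_eq: "q u = alternant a u / alternant staircase u" if "inj (($) u)" for u
    using \<kappa>(1) diff_prod_nonzero[OF that] by (simp add: q_def p(2) \<kappa>(2) divide_simps)
  have "\<exists>!p. real_polynomial_function p \<and>
     (\<forall>u. inj (($) u) \<longrightarrow> p u = alternant a u / alternant staircase u)"
  proof (rule ex1I[of _ q])
    show "real_polynomial_function q \<and>
        (\<forall>u. inj (($) u) \<longrightarrow> q u = alternant a u / alternant staircase u)"
      using q q_eq by blast
    fix r assume r: "real_polynomial_function r \<and>
        (\<forall>u. inj (($) u) \<longrightarrow> r u = alternant a u / alternant staircase u)"
    show "r = q"
    proof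
      fix u show "r u = q u"
        by (rule continuous_eq_on_distinct) (use r q q_eq in \<open>auto intro: continuous_on_real_polynomial_function\<close>)
    qed
  qed
  then show ?thesis unfolding schur_altdef by (rule theI')
qed

lemma real_polynomial_function_schur: "real_polynomial_function (schur a)"
  using schur_spec by blast

lemma schur_distinct:
  "inj (($) u) \<Longrightarrow> schur a u = alternant a u / alternant staircase u"
  using schur_spec by blast

lemma schur_eq_det_ratio:
  assumes "u \<in> pos_orthant_distinct"
  shows "schur a u = det_ratio (\<chi> j. real (position j)) (\<chi> j. real (a $ j)) u"
proof -
  have "u \<in> pos_orthant" "inj (($) u)" using assms by (auto simp: pos_orthant_distinct_def)
  then show ?thesis by (simp add: schur_distinct alternant_eq_det_powr det_ratio_def staircase_def)
qed

section \<open>Positivity of Schur polynomials\<close>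

text \<open>
The staircase lies below any strictly increasing tuple of natural numbers. This lets the results on
\<open>det_ratio\<close> apply to a single Schur polynomial.
\<close>

lemma position_le_strict_mono:
  assumes "strict_mono (f :: 'n::{finite,linorder} \<Rightarrow> nat)"
  shows "position j \<le> f j"
proof -
  have "card (f ` {k. k < j}) \<le> card {..<f j}"
    using assms by (intro card_mono) (auto simp: strict_mono_less)
  then show ?thesis
    using strict_mono_imp_inj_on[OF assms] by (simp add: position_def card_image inj_on_subset)
qed

text \<open>
Perturbing both tuples along the same direction changes neither the coordinates in which they differ
nor the size of the difference, so the hypothesis applies before passing to the limit.
\<close>

lemma weakly_increasing_on_pos_orthant:
  fixes f :: "real ^ ('n::{finite,linorder}) \<Rightarrow> real"
  assumes f: "continuous_on pos_orthant f"
    and incr: "\<And>u v. u \<in> pos_orthant_distinct \<Longrightarrow> v \<in> pos_orthant_distinct \<Longrightarrow>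
      u $ i < v $ i \<Longrightarrow> (\<And>j. j \<noteq> i \<Longrightarrow> u $ j = v $ j) \<Longrightarrow> f u \<le> f v"
    and u: "u \<in> pos_orthant" and v: "v \<in> pos_orthant"
    and uv: "u $ i < v $ i" "\<And>j. j \<noteq> i \<Longrightarrow> u $ j = v $ j"
  shows "f u \<le> f v"
proof (rule tendsto_le)
  show "((\<lambda>e. f (u + e *\<^sub>R position_vec)) \<longlongrightarrow> f u) (at_right 0)"
    by (rule tendsto_along_direction[OF f u]) (rule pos_orthant_position_vec[OF u])
  show "((\<lambda>e. f (v + e *\<^sub>R position_vec)) \<longlongrightarrow> f v) (at_right 0)"
    by (rule tendsto_along_direction[OF f v]) (rule pos_orthant_position_vec[OF v])
  show "\<forall>\<^sub>F e in at_right 0. f (u + e *\<^sub>R position_vec) \<le> f (v + e *\<^sub>R position_vec)"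
    using eventually_pos_orthant_distinct[OF u] eventually_pos_orthant_distinct[OF v]
    by eventually_elim (rule incr; simp add: uv)
qed simp

lemma strict_mono_exponents:
  fixes a :: "nat ^ ('n::{finite,linorder})"
  assumes "strict_mono (($) a)"
  shows "strict_mono (($) (\<chi> j :: 'n. real (position j)))" "strict_mono (($) (\<chi> j. real (a $ j)))"
    and "(\<chi> j. real (position j)) $ j \<le> (\<chi> j. real (a $ j)) $ j"
  using strict_mono_position assms position_le_strict_mono[OF assms, of j]
  by (auto simp: strict_mono_def)

lemma schur_pos_distinct:
  assumes a: "strict_mono (($) a)" and u: "u \<in> pos_orthant_distinct"
  shows "0 < schur a u"
  unfolding schur_eq_det_ratio[OF u] by (intro det_ratio_pos strict_mono_exponents[OF a] u)

lemma schur_weakly_increasing: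
  assumes a: "strict_mono (($) a)"
    and u: "u \<in> pos_orthant" and v: "v \<in> pos_orthant"
    and uv: "u $ i < v $ i" "\<And>j. j \<noteq> i \<Longrightarrow> u $ j = v $ j"
  shows "schur a u \<le> schur a v"
proof (rule weakly_increasing_on_pos_orthant[OF _ _ u v uv])
  show "continuous_on pos_orthant (schur a)"
    by (intro continuous_on_real_polynomial_function real_polynomial_function_schur)
  fix u v
  assume uv: "u \<in> pos_orthant_distinct" "v \<in> pos_orthant_distinct" "u $ i < v $ i"
    "\<And>j. j \<noteq> i \<Longrightarrow> u $ j = v $ j"
  show "schur a u \<le> schur a v"
    unfolding schur_eq_det_ratio[OF uv(1)] schur_eq_det_ratio[OF uv(2)]
    using det_ratio_less_or_eq[OF strict_mono_exponents[OF a] uv]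
      det_ratio_self[OF strict_mono_exponents(2)[OF a]] uv by fastforce
qed

text \<open>
Pass from \<open>w\<close> to \<open>u\<close> by replacing the coordinates in a growing set \<open>S\<close>.
\<close>

lemma coordwise_increasing_imp_mono:
  fixes f :: "real ^ 'n \<Rightarrow> real"
  assumes incr: "\<And>u v i. u \<in> pos_orthant \<Longrightarrow> v \<in> pos_orthant \<Longrightarrow> u $ i < v $ i \<Longrightarrow>
      (\<And>j. j \<noteq> i \<Longrightarrow> u $ j = v $ j) \<Longrightarrow> f u \<le> f v"
    and w: "w \<in> pos_orthant" and u: "u \<in> pos_orthant" and wu: "\<And>i. w $ i \<le> u $ i"
  shows "f w \<le> f u"
proof -
  have "f w \<le> f (\<chi> i. if i \<in> S then u $ i else w $ i)" if "finite S" for S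
    using that
  proof (induction S)
    case empty
    then show ?case by simp
  next
    case (insert k S)
    let ?x = "\<lambda>S. \<chi> i. if i \<in> S then u $ i else w $ i"
    have pos: "?x S \<in> pos_orthant" for S using u w by (simp add: pos_orthant_def)
    have "f (?x S) \<le> f (?x (insert k S))"
    proof (cases "w $ k = u $ k")
      case True
      then have "?x S = ?x (insert k S)" by (auto simp: vec_eq_iff)
      then show ?thesis by simp
    next
      case False
      then show ?thesis using insert.hyps wu[of k] by (intro incr[OF pos pos, of _ k]) auto
    qed
    then show ?case using insert.IH by simp
  qed
  from this[of UNIV] show ?thesis by simp
qed

lemma distinct_below:
  fixes u :: "real ^ ('n::{finite,linorder})"
  assumes u: "u \<in> pos_orthant"
  shows "\<exists>w\<in>pos_orthant_distinct. \<forall>i. w $ i \<le> u $ i"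
proof -
  define c where "c = Min (range (($) u)) / real (Suc CARD('n))"
  have "Min (range (($) u)) \<in> range (($) u)" by (intro Min_in) auto
  then have Min: "0 < Min (range (($) u))" using u by (auto simp: pos_orthant_def)
  then have c: "0 < c" by (simp add: c_def)
  have "c * position_vec $ i \<le> u $ i" for i
  proof -
    have "position i \<le> CARD('n)" unfolding position_def by (intro card_mono) auto
    then have "position_vec $ i \<le> real (Suc CARD('n))" by (simp add: position_vec_def)
    then have "c * position_vec $ i \<le> c * real (Suc CARD('n))" using c by (intro mult_left_mono) auto
    also have "\<dots> = Min (range (($) u))" by (simp add: c_def)
    also have "\<dots> \<le> u $ i" by (intro Min_le) auto
    finally show ?thesis .
  qed
  moreover have "c *\<^sub>R position_vec \<in> (pos_orthant_distinct :: (real ^ ('n::{finite,linorder})) set)"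
    using c injD[OF inj_position_vec]
    by (auto simp: pos_orthant_distinct_def pos_orthant_def position_vec_pos intro!: injI)
  ultimately show ?thesis by (intro bexI[of _ "c *\<^sub>R position_vec"]) auto
qed

text \<open>
Positivity at tuples with repeated entries: below any positive tuple there is one with distinct
entries, where the value is a positive \<open>det_ratio\<close>, and Schur polynomials are weakly increasing.
\<close>

lemma schur_pos:
  fixes a :: "nat ^ ('n::{finite,linorder})"
  assumes a: "strict_mono (($) a)" and u: "u \<in> pos_orthant"
  shows "0 < schur a u"
proof -
  obtain w where w: "w \<in> pos_orthant_distinct" "\<And>i. w $ i \<le> u $ i" using distinct_below[OF u] by blast
  have "0 < schur a w" by (rule schur_pos_distinct[OF a w(1)])
  also have "schur a w \<le> schur a u"
    using w by (intro coordwise_increasing_imp_mono[OF schur_weakly_increasing[OF a] _ u])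
      (auto simp: pos_orthant_distinct_def)
  finally show ?thesis .
qed

section \<open>Descartes' bound with multiplicities\<close>

definition poly_support :: "'a::zero poly \<Rightarrow> nat set" where
  "poly_support p = {l. coeff p l \<noteq> 0}"

lemma finite_poly_support [simp]: "finite (poly_support p)"
  by (rule finite_subset[of _ "{..degree p}"]) (auto simp: poly_support_def le_degree)

lemma poly_support_empty_iff [simp]: "poly_support p = {} \<longleftrightarrow> p = 0"
  by (auto simp: poly_support_def poly_eq_iff)

text \<open>
The operator \<open>X p' - k p\<close>, the counterpart for polynomials of the one in \<open>gpoly_euler\<close>: it keeps all
exponents of \<open>p\<close> except \<open>k\<close>, which it removes.
\<close>

definition euler_op :: "nat \<Rightarrow> real poly \<Rightarrow> real poly" where
  "euler_op k p = [:0, 1:] * pderiv p - smult (real k) p"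

lemma coeff_euler_op: "coeff (euler_op k p) l = (real l - real k) * coeff p l"
  by (cases l) (auto simp: euler_op_def coeff_pderiv coeff_pCons algebra_simps)

lemma poly_support_euler_op: "poly_support (euler_op k p) = poly_support p - {k}"
  by (auto simp: poly_support_def coeff_euler_op)

lemma order_euler_op:
  assumes "p \<noteq> 0" "euler_op k p \<noteq> 0"
  shows "order z p \<le> Suc (order z (euler_op k p))"
proof (cases "order z p")
  case (Suc n)
  obtain q where q: "p = [:-z, 1:] ^ Suc n * q" using order_1[of z p] Suc by (auto elim: dvdE)
  have "[:-z, 1:] ^ n dvd pderiv p"
    unfolding q lemma_order_pderiv1
    by (intro dvd_add dvd_smult dvd_mult2 dvd_mult le_imp_power_dvd) auto
  moreover have "[:-z, 1:] ^ n dvd p" unfolding q by (intro dvd_mult2 le_imp_power_dvd) simp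
  ultimately have "[:-z, 1:] ^ n dvd euler_op k p"
    unfolding euler_op_def by (intro dvd_diff dvd_smult dvd_mult)
  then show ?thesis using assms(2) Suc by (simp add: order_divides)
qed simp

text \<open>
The argument of \<open>gpoly_card_zeros\<close> with multiplicities: under \<open>euler_op\<close> each root loses at most one in
multiplicity, and the roots between the old ones make up for all of this loss but one.
\<close>

lemma sum_order_pos_roots_less:
  fixes p :: "real poly"
  assumes "p \<noteq> 0"
  shows "(\<Sum>z | 0 < z \<and> poly p z = 0. order z p) < card (poly_support p)"
  using assms
proof (induction "card (poly_support p)" arbitrary: p rule: less_induct)
  case less
  let ?R = "\<lambda>p :: real poly. {z. 0 < z \<and> poly p z = 0}"
  have fin: "finite (?R p)" if "p \<noteq> 0" for p
    using poly_roots_finite[OF that] by (rule finite_subset[rotated]) auto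
  obtain k where k: "k \<in> poly_support p" using less.prems by (metis equals0I poly_support_empty_iff)
  let ?q = "euler_op k p"
  have card: "card (poly_support p) = Suc (card (poly_support ?q))"
    unfolding poly_support_euler_op using k by (intro card.remove) auto
  show ?case
  proof (cases "?q = 0")
    case True
    then have "poly_support p - {k} = {}"
      by (simp only: poly_support_empty_iff flip: poly_support_euler_op)
    then have "poly_support p = {k}" using k by blast
    then have eq: "p = monom (coeff p k) k"
      by (auto simp: poly_eq_iff poly_support_def)
    have "poly p z = coeff p k * z ^ k" for z
      using arg_cong[OF eq, of "\<lambda>p. poly p z"] by (simp only: poly_monom)
    moreover have "coeff p k \<noteq> 0" using k by (simp add: poly_support_def)
    ultimately have no_roots: "?R p = {}" by auto
    show ?thesis unfolding no_roots using card by simp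
  next
    case False
    have "\<exists>Z'. finite Z' \<and> Z' \<subseteq> {0<..} \<and> ?R p \<inter> Z' = {} \<and>
        (\<forall>w\<in>Z'. w * poly (pderiv p) w = real k * poly p w) \<and> card (?R p) \<le> Suc (card Z')"
      by (rule euler_rolle[OF fin[OF less.prems] _ _ poly_DERIV]) auto
    then obtain Z' where Z': "finite Z'" "Z' \<subseteq> {0<..}" "?R p \<inter> Z' = {}"
        "\<forall>w\<in>Z'. w * poly (pderiv p) w = real k * poly p w" "card (?R p) \<le> Suc (card Z')"
      by (elim exE conjE) (rule that)
    have Z'_sub: "Z' \<subseteq> ?R ?q" using Z'(2,4) by (auto simp: euler_op_def)
    have fin_q: "finite (?R ?q)" by (rule fin[OF False])
    have "(\<Sum>z\<in>?R p. order z p) \<le> (\<Sum>z\<in>?R p. Suc (order z ?q))"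
      by (intro sum_mono order_euler_op less.prems False)
    also have "\<dots> = (\<Sum>z\<in>?R p. order z ?q) + card (?R p)"
      unfolding Suc_eq_plus1 sum.distrib by simp
    also have "\<dots> \<le> (\<Sum>z\<in>?R p. order z ?q) + Suc (\<Sum>z\<in>Z'. 1)" using Z'(5) by simp
    also have "(\<Sum>z\<in>Z'. 1) \<le> (\<Sum>z\<in>Z'. order z ?q)"
    proof (rule sum_mono)
      fix z assume "z \<in> Z'"
      then have "order z ?q \<noteq> 0" using Z'_sub False by (auto simp: order_root)
      then show "1 \<le> order z ?q" by simp
    qed
    also have "(\<Sum>z\<in>?R p. order z ?q) + Suc (\<Sum>z\<in>Z'. order z ?q) = Suc (\<Sum>z\<in>?R p \<union> Z'. order z ?q)"
      using Z' fin[OF less.prems] by (simp add: sum.union_disjoint)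
    also have "(\<Sum>z\<in>?R p \<union> Z'. order z ?q) \<le> (\<Sum>z\<in>?R ?q. order z ?q)"
    proof -
      have "(\<Sum>z\<in>?R p \<union> Z'. order z ?q) = (\<Sum>z\<in>(?R p \<union> Z') \<inter> ?R ?q. order z ?q)"
        using Z'(1,2) fin[OF less.prems] by (intro sum.mono_neutral_right) (auto dest: order_0I[THEN eq_refl] simp: order_root False)
      also have "\<dots> \<le> (\<Sum>z\<in>?R ?q. order z ?q)"
        using fin_q by (intro sum_mono2) auto
      finally show ?thesis .
    qed
    also have "(\<Sum>z\<in>?R ?q. order z ?q) < card (poly_support ?q)"
      using card False by (intro less.hyps) auto
    finally show ?thesis using card by simp
  qed
qed

lemma card_pos_linear_factors_less:
  fixes p :: "real poly" and x :: "'i \<Rightarrow> real"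
  assumes "p \<noteq> 0" "finite J" "\<And>j. j \<in> J \<Longrightarrow> 0 < x j" and dvd: "(\<Prod>j\<in>J. [:- x j, 1:]) dvd p"
  shows "card J < card (poly_support p)"
proof -
  have mult: "card {j\<in>J. x j = z} \<le> order z p" for z
  proof -
    have "(\<Prod>j\<in>{j\<in>J. x j = z}. [:- x j, 1:]) dvd (\<Prod>j\<in>J. [:- x j, 1:])"
      using assms(2) by (intro prod_dvd_prod_subset) auto
    moreover have "(\<Prod>j\<in>{j\<in>J. x j = z}. [:- x j, 1:]) = [:- z, 1:] ^ card {j\<in>J. x j = z}"
      by simp
    ultimately have "[:- z, 1:] ^ card {j\<in>J. x j = z} dvd p" using dvd_trans[OF _ dvd] by simp
    then show ?thesis using assms(1) by (simp add: order_divides)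
  qed
  have root: "poly p (x j) = 0" if "j \<in> J" for j
  proof -
    have "[:- x j, 1:] dvd p" by (rule dvd_trans[OF dvd_prodI[OF assms(2) that] dvd])
    then show ?thesis by (simp add: poly_eq_0_iff_dvd)
  qed
  have "card J = (\<Sum>z\<in>x ` J. card {j\<in>J. x j = z})"
    using sum.image_gen[OF assms(2), of "\<lambda>_. 1::nat" x] by simp
  also have "\<dots> \<le> (\<Sum>z\<in>x ` J. order z p)" by (intro sum_mono mult)
  also have "\<dots> \<le> (\<Sum>z | 0 < z \<and> poly p z = 0. order z p)"
    using assms root poly_roots_finite[OF assms(1)]
    by (intro sum_mono2) (auto intro: finite_subset[of _ "{z. poly p z = 0}"])
  also have "\<dots> < card (poly_support p)" by (rule sum_order_pos_roots_less[OF assms(1)])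
  finally show ?thesis .
qed

section \<open>Schur polynomials as polynomials in one coordinate\<close>

text \<open>
A polynomial function of all coordinates, read as a univariate polynomial in coordinate \<open>i\<close>. The
continuity of its coefficients in \<open>u\<close> permits passing to tuples with repeated entries.
\<close>

lemma real_polynomial_function_coord_poly:
  fixes p :: "real ^ 'n \<Rightarrow> real"
  assumes "real_polynomial_function p"
  shows "\<exists>q. (\<forall>u t. poly (q u) t = p (upd_coord u i t)) \<and> (\<forall>l. continuous_on UNIV (\<lambda>u. coeff (q u) l))"
  using assms
proof (induction p rule: real_polynomial_function.induct)
  case (linear f)
  interpret bounded_linear f by fact
  define q where "q u = [: f u - u $ i * f (axis i 1), f (axis i 1) :]" for u
  have upd: "upd_coord u i t = u + (t - u $ i) *\<^sub>R axis i 1" for u t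
    by (simp add: vec_eq_iff axis_def)
  have "poly (q u) t = f (upd_coord u i t)" for u t
    unfolding upd add scale by (simp add: q_def algebra_simps)
  moreover have "continuous_on UNIV (\<lambda>u. coeff (q u) l)" for l
  proof -
    have "coeff (q u) l = (if l = 0 then f u - u $ i * f (axis i 1) else if l = 1 then f (axis i 1) else 0)" for u
      by (auto simp: q_def coeff_pCons split: nat.splits)
    then show ?thesis
      using linear_continuous_on[OF linear.hyps, of UNIV]
      by (cases "l = 0"; cases "l = 1") (auto intro!: continuous_intros)
  qed
  ultimately show ?case by blast
next
  case (const c)
  have "continuous_on UNIV (\<lambda>u :: real ^ 'n. coeff [:c:] l)" for l by simp
  then show ?case by (intro exI[of _ "\<lambda>_. [:c:]"]) auto
next
  case (add f g)
  then obtain q r where "\<forall>u t. poly (q u) t = f (upd_coord u i t)" "\<forall>l. continuous_on UNIV (\<lambda>u. coeff (q u) l)"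
    "\<forall>u t. poly (r u) t = g (upd_coord u i t)" "\<forall>l. continuous_on UNIV (\<lambda>u. coeff (r u) l)" by blast
  then show ?case
    by (intro exI[of _ "\<lambda>u. q u + r u"]) (auto intro!: continuous_intros)
next
  case (mult f g)
  then obtain q r where "\<forall>u t. poly (q u) t = f (upd_coord u i t)" "\<forall>l. continuous_on UNIV (\<lambda>u. coeff (q u) l)"
    "\<forall>u t. poly (r u) t = g (upd_coord u i t)" "\<forall>l. continuous_on UNIV (\<lambda>u. coeff (r u) l)" by blast
  then show ?case
    by (intro exI[of _ "\<lambda>u. q u * r u"]) (auto simp: coeff_mult intro!: continuous_intros)
qed

lemma alternant_upd:
  "alternant a (upd_coord u i t) = (\<Sum>k\<in>UNIV. t ^ (a $ k) * row_minor (\<chi> i j. u $ i ^ (a $ j)) i k)"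
proof -
  have "row_minor (\<chi> r j. upd_coord u i t $ r ^ (a $ j)) i k = row_minor (\<chi> i j. u $ i ^ (a $ j)) i k" for k
    by (rule row_minor_cong) simp
  then show ?thesis
    unfolding alternant_def by (subst det_row_expansion[of _ i]) simp
qed

text \<open>
The differences not involving \<open>i\<close> do not depend on the coordinate \<open>i\<close>. At tuples with distinct entries
the quotient is therefore, up to a constant factor, the expansion of the alternant along row \<open>i\<close>,
and it has no other exponents; by continuity of the coefficients this holds at all tuples.
\<close>

lemma poly_support_coord_quotient:
  fixes a :: "nat ^ ('n::{finite,linorder})"
  assumes S: "S = {(j, l). j < l \<and> j \<noteq> i \<and> l \<noteq> i}"
    and eq: "\<And>u. alternant a u = (\<Prod>(j,l)\<in>S. u $ j - u $ l) * G u"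
    and q: "\<And>u t. poly (q u) t = G (upd_coord u i t)"
    and cont: "\<And>l. continuous_on UNIV (\<lambda>u. coeff (q u) l)"
  shows "poly_support (q u) \<subseteq> range (($) a)"
proof -
  have "coeff (q u) l = 0" if l: "l \<notin> range (($) a)" for l
  proof (rule continuous_eq_on_distinct[of "\<lambda>u. coeff (q u) l" "\<lambda>_. 0" u])
    fix u :: "real ^ ('n::{finite,linorder})" assume inj: "inj (($) u)"
    define W where "W = (\<Prod>(j,l)\<in>S. u $ j - u $ l)"
    have "W \<noteq> 0" using inj unfolding W_def S by (auto simp: prod_zero_iff dest: injD)
    have W: "(\<Prod>(j,l)\<in>S. upd_coord u i t $ j - upd_coord u i t $ l) = W" for t
      unfolding W_def S by (intro prod.cong) auto
    have "poly (smult W (q u)) t =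
        poly (\<Sum>k\<in>UNIV. monom (row_minor (\<chi> i j. u $ i ^ (a $ j)) i k) (a $ k)) t" for t
      using eq[of "upd_coord u i t"] unfolding W alternant_upd
      by (simp add: q poly_sum poly_monom mult_ac)
    then have "coeff (smult W (q u)) l =
        coeff (\<Sum>k\<in>UNIV. monom (row_minor (\<chi> i j. u $ i ^ (a $ j)) i k) (a $ k)) l"
      by (intro arg_cong[of _ _ "\<lambda>p. coeff p l"] poly_ext)
    also have "\<dots> = (\<Sum>k\<in>UNIV. coeff (monom (row_minor (\<chi> i j. u $ i ^ (a $ j)) i k) (a $ k)) l)"
      by (rule coeff_sum)
    also have "\<dots> = 0" using l by (intro sum.neutral ballI) (simp, metis rangeI)
    finally show "coeff (q u) l = 0" using \<open>W \<noteq> 0\<close> by simp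
  qed (use cont in auto)
  then show ?thesis by (auto simp: poly_support_def)
qed

text \<open>
Separates the differences that involve \<open>i\<close>; a factor \<open>-1\<close> appears for each of them whose first
index is \<open>i\<close>.
\<close>

lemma diff_prod_split:
  fixes u :: "real ^ ('n::{finite,linorder})"
  shows "diff_prod u = (\<Prod>(j,l)\<in>{(j, l). j < l \<and> j \<noteq> i \<and> l \<noteq> i}. u $ j - u $ l) *
    ((\<Prod>j\<in>UNIV-{i}. if j < i then 1 else -1) * (\<Prod>j\<in>UNIV-{i}. u $ j - u $ i))"
proof -
  let ?A = "{(j, l). j < l \<and> j \<noteq> i \<and> l \<noteq> i}" and ?B = "{(j, l). j < l \<and> (j = i \<or> l = i)}"
  have "diff_prod u = (\<Prod>(j,l)\<in>?A. u $ j - u $ l) * (\<Prod>(j,l)\<in>?B. u $ j - u $ l)"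
    unfolding diff_prod_def by (subst prod.union_disjoint[symmetric]) (auto intro!: prod.cong)
  also have "(\<Prod>(j,l)\<in>?B. u $ j - u $ l) = (\<Prod>j\<in>UNIV-{i}. (if j < i then 1 else -1) * (u $ j - u $ i))"
    by (rule prod.reindex_bij_witness[where i="\<lambda>j. if j < i then (j, i) else (i, j)"
          and j="\<lambda>(j, l). if j = i then l else j"]) auto
  finally show ?thesis by (simp only: prod.distrib)
qed

text \<open>
Up to a nonzero constant, \<open>\<Prod>\<^sub>j (t - u $ j) * schur a\<close>, over \<open>j \<noteq> i\<close>, is the alternant divided by the
differences not involving \<open>i\<close>. Unlike the alternant, it does not degenerate when other coordinates coincide.
\<close>

lemma schur_coord_poly:
  fixes a :: "nat ^ ('n::{finite,linorder})"
  shows "\<exists>q. (\<forall>t. poly q t = schur a (upd_coord u i t)) \<and>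
    poly_support ((\<Prod>j\<in>UNIV-{i}. [:- u $ j, 1:]) * q) \<subseteq> range (($) a)"
proof -
  define S where "S = {(j :: 'n, l). j < l \<and> j \<noteq> i \<and> l \<noteq> i}"
  obtain G where G: "real_polynomial_function G"
    and G_eq: "\<And>u. alternant a u = (\<Prod>(j,l)\<in>S. u $ j - u $ l) * G u"
    using alternant_divisible[of S a] unfolding S_def by auto
  obtain qG where qG: "\<And>u t. poly (qG u) t = G (upd_coord u i t)"
    and qG_cont: "\<And>l. continuous_on UNIV (\<lambda>u. coeff (qG u) l)"
    using real_polynomial_function_coord_poly[OF G, of i] by blast
  obtain q where q: "\<And>u t. poly (q u) t = schur a (upd_coord u i t)"
    using real_polynomial_function_coord_poly[OF real_polynomial_function_schur[of a], of i] by blast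
  obtain \<kappa> where \<kappa>: "\<kappa> \<noteq> 0" "\<And>u :: real ^ ('n::{finite,linorder}). alternant staircase u = \<kappa> * diff_prod u"
    using vandermonde by blast
  define s where "s = \<kappa> * (\<Prod>j\<in>UNIV-{i}. if j < i then 1 else -1) * (-1) ^ card (UNIV - {i})"
  have "s \<noteq> 0" using \<kappa> by (auto simp: s_def prod_zero_iff)
  have G_schur: "G u = \<kappa> * (\<Prod>j\<in>UNIV-{i}. if j < i then 1 else -1) * (\<Prod>j\<in>UNIV-{i}. u $ j - u $ i) * schur a u" for u
  proof (rule continuous_eq_on_distinct)
    show "continuous_on UNIV G" by (rule continuous_on_real_polynomial_function[OF G])
    show "continuous_on UNIV (\<lambda>u. \<kappa> * (\<Prod>j\<in>UNIV-{i}. if j < i then 1 else -1) * (\<Prod>j\<in>UNIV-{i}. u $ j - u $ i) * schur a u)"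
      by (intro continuous_intros continuous_on_real_polynomial_function real_polynomial_function_schur)
  next
    fix u :: "real ^ ('n::{finite,linorder})" assume inj: "inj (($) u)"
    have "alternant a u = \<kappa> * diff_prod u * schur a u"
      using schur_distinct[OF inj, of a] alternant_staircase_nonzero[OF inj] \<kappa>(2) by simp
    moreover have "(\<Prod>(j,l)\<in>S. u $ j - u $ l) \<noteq> 0"
      using inj unfolding S_def by (auto simp: prod_zero_iff dest: injD)
    ultimately show "G u = \<kappa> * (\<Prod>j\<in>UNIV-{i}. if j < i then 1 else -1) * (\<Prod>j\<in>UNIV-{i}. u $ j - u $ i) * schur a u"
      using G_eq[of u] diff_prod_split[of u i] by (simp add: S_def[symmetric])
  qed
  have "poly (qG u) t = poly (smult s ((\<Prod>j\<in>UNIV-{i}. [:- u $ j, 1:]) * q u)) t" for t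
  proof -
    have "(\<Prod>j\<in>UNIV-{i}. upd_coord u i t $ j - upd_coord u i t $ i) = (\<Prod>j\<in>UNIV-{i}. (-1) * (t - u $ j))"
      by (intro prod.cong) auto
    also have "\<dots> = (-1) ^ card (UNIV - {i}) * (\<Prod>j\<in>UNIV-{i}. t - u $ j)"
      by (simp only: prod.distrib prod_constant)
    finally show ?thesis
      unfolding qG G_schur by (simp add: s_def q poly_prod)
  qed
  then have eq: "qG u = smult s ((\<Prod>j\<in>UNIV-{i}. [:- u $ j, 1:]) * q u)" by (rule poly_ext)
  have "poly_support ((\<Prod>j\<in>UNIV-{i}. [:- u $ j, 1:]) * q u) = poly_support (qG u)"
    unfolding eq using \<open>s \<noteq> 0\<close> by (simp add: poly_support_def)
  also have "\<dots> \<subseteq> range (($) a)"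
    by (rule poly_support_coord_quotient[OF S_def G_eq qG qG_cont])
  finally show ?thesis using q by blast
qed

text \<open>
Proportionality on an infinite set of values of the coordinate \<open>i\<close> is proportionality as polynomials,
which leaves only exponents common to both tuples, fewer than \<open>N\<close>. But the product with the linear
factors has \<open>N - 1\<close> positive roots with multiplicity, and it is nonzero since Schur polynomials are positive.
\<close>

lemma schur_ratio_not_const:
  fixes a b :: "nat ^ ('n::{finite,linorder})"
  assumes a: "strict_mono (($) a)" and b: "strict_mono (($) b)" and ab: "range (($) a) \<noteq> range (($) b)"
    and u: "u \<in> pos_orthant" and T: "infinite T"
    and const: "\<And>t. t \<in> T \<Longrightarrow> schur b (upd_coord u i t) = c * schur a (upd_coord u i t)"
  shows False
proof -
  let ?w = "\<Prod>j\<in>UNIV-{i}. [:- u $ j, 1:]"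
  obtain qa where qa: "\<And>t. poly qa t = schur a (upd_coord u i t)" "poly_support (?w * qa) \<subseteq> range (($) a)"
    using schur_coord_poly by blast
  obtain qb where qb: "\<And>t. poly qb t = schur b (upd_coord u i t)" "poly_support (?w * qb) \<subseteq> range (($) b)"
    using schur_coord_poly by blast
  have "qb - smult c qa = 0"
  proof (rule ccontr)
    assume "qb - smult c qa \<noteq> 0"
    then have "finite {t. poly (qb - smult c qa) t = 0}" by (rule poly_roots_finite)
    moreover have "T \<subseteq> {t. poly (qb - smult c qa) t = 0}" using const by (auto simp: qa qb)
    ultimately show False using T finite_subset by blast
  qed
  then have eq: "qb = smult c qa" by simp
  have "poly qb (u $ i) \<noteq> 0" using schur_pos[OF b u] by (simp add: qb)
  then have "qb \<noteq> 0" by auto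
  then have nz: "?w * qb \<noteq> 0" by (simp add: prod_zero_iff)
  have "poly_support (?w * qb) \<subseteq> poly_support (?w * qa)"
    unfolding eq by (auto simp: poly_support_def)
  then have sub: "poly_support (?w * qb) \<subseteq> range (($) a) \<inter> range (($) b)" using qa qb by blast
  have card: "card (range (($) a)) = CARD('n)" "card (range (($) b)) = CARD('n)"
    using strict_mono_imp_inj_on[OF a] strict_mono_imp_inj_on[OF b] by (auto simp: card_image)
  have "\<not> range (($) a) \<subseteq> range (($) b)"
  proof
    assume "range (($) a) \<subseteq> range (($) b)"
    then have "range (($) a) = range (($) b)" by (intro card_subset_eq) (simp_all add: card)
    with ab show False by contradiction
  qed
  then have "range (($) a) \<inter> range (($) b) \<subset> range (($) a)" by blast
  then have "card (range (($) a) \<inter> range (($) b)) < CARD('n)"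
    using psubset_card_mono[of "range (($) a)"] card by auto
  moreover have "card (poly_support (?w * qb)) \<le> card (range (($) a) \<inter> range (($) b))"
    using sub by (intro card_mono) auto
  moreover have "card (UNIV - {i}) < card (poly_support (?w * qb))"
    using u by (intro card_pos_linear_factors_less[OF nz, of _ "\<lambda>j. u $ j"]) (auto simp: pos_orthant_def)
  ultimately show False by simp
qed

text \<open>
Comparable tuples with the same set of entries have the same sum, so they agree.
\<close>

lemma range_exponents_eq_imp_eq:
  fixes a b :: "nat ^ ('n::finite)"
  assumes "inj (($) a)" "inj (($) b)" "range (($) a) = range (($) b)" and le: "\<And>j. a $ j \<le> b $ j"
  shows "a = b"
proof (rule ccontr)
  assume "a \<noteq> b"
  then obtain j where "a $ j \<noteq> b $ j" by (auto simp: vec_eq_iff)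
  then have "(\<Sum>j\<in>UNIV. a $ j) < (\<Sum>j\<in>UNIV. b $ j)"
    using le by (intro sum_strict_mono_ex1) (auto intro!: exI[of _ j] simp: order_less_le)
  moreover have "(\<Sum>j\<in>UNIV. a $ j) = \<Sum>(range (($) a))" "(\<Sum>j\<in>UNIV. b $ j) = \<Sum>(range (($) b))"
    using assms(1,2) by (simp_all add: sum.reindex)
  ultimately show False using assms(3) by simp
qed

lemma schur_ratio_eq_det_ratio:
  assumes "u \<in> pos_orthant_distinct"
  shows "schur b u / schur a u = det_ratio (\<chi> j. real (a $ j)) (\<chi> j. real (b $ j)) u"
proof -
  have "u \<in> pos_orthant" "inj (($) u)" using assms by (auto simp: pos_orthant_distinct_def)
  then show ?thesis
    using alternant_staircase_nonzero[of u] by (simp add: schur_distinct alternant_eq_det_powr det_ratio_def)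
qed

lemma continuous_on_schur_ratio:
  assumes "strict_mono (($) a)"
  shows "continuous_on pos_orthant (\<lambda>u. schur b u / schur a u)"
proof -
  have "schur a u \<noteq> 0" if "u \<in> pos_orthant" for u using schur_pos[OF assms that] by simp
  then show ?thesis
    by (intro continuous_on_divide continuous_on_real_polynomial_function real_polynomial_function_schur) auto
qed

lemma schur_ratio_strictly_increasing:
  fixes a b :: "nat ^ ('n::{finite,linorder})"
  assumes a: "strict_mono (($) a)" and b: "strict_mono (($) b)" and ab: "\<And>j. a $ j \<le> b $ j" "a \<noteq> b"
  shows "strictly_increasing_each_coord_on pos_orthant (\<lambda>u. schur b u / schur a u)"
  unfolding strictly_increasing_each_coord_on_def
proof (intro ballI allI impI)
  let ?f = "\<lambda>u. schur b u / schur a u"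
  fix u v :: "real ^ ('n::{finite,linorder})" and i :: 'n
  assume u: "u \<in> pos_orthant" and v: "v \<in> pos_orthant"
    and uv: "u $ i < v $ i \<and> (\<forall>j. j \<noteq> i \<longrightarrow> u $ j = v $ j)"
  have distinct: "?f x \<le> ?f y" if xy: "x \<in> pos_orthant_distinct" "y \<in> pos_orthant_distinct"
      "x $ i < y $ i" "\<And>j. j \<noteq> i \<Longrightarrow> x $ j = y $ j" for x y
    unfolding schur_ratio_eq_det_ratio[OF xy(1)] schur_ratio_eq_det_ratio[OF xy(2)]
    using det_ratio_less_or_eq[OF strict_mono_exponents(2)[OF a] strict_mono_exponents(2)[OF b] _ xy] ab
    by (auto simp: vec_eq_iff)
  have mono: "?f x \<le> ?f y" if "x \<in> pos_orthant" "y \<in> pos_orthant"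
      "x $ i < y $ i" "\<And>j. j \<noteq> i \<Longrightarrow> x $ j = y $ j" for x y
    by (rule weakly_increasing_on_pos_orthant[OF continuous_on_schur_ratio[OF a] distinct that])
  show "?f u < ?f v"
  proof (rule ccontr)
    assume "\<not> ?f u < ?f v"
    have "schur b (upd_coord u i t) = ?f u * schur a (upd_coord u i t)" if t: "t \<in> {u $ i<..<v $ i}" for t
    proof -
      have w: "upd_coord u i t \<in> pos_orthant" using u t by (auto simp: pos_orthant_def intro: less_trans)
      have "?f u \<le> ?f (upd_coord u i t)" using t by (intro mono u w) auto
      moreover have "?f (upd_coord u i t) \<le> ?f v" using t uv by (intro mono v w) auto
      ultimately have "?f (upd_coord u i t) = ?f u" using \<open>\<not> ?f u < ?f v\<close> by linarith
      then show ?thesis using schur_pos[OF a w] by (simp add: field_simps)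
    qed
    moreover have "range (($) a) \<noteq> range (($) b)"
      using range_exponents_eq_imp_eq[of a b] ab strict_mono_imp_inj_on[OF a] strict_mono_imp_inj_on[OF b] by auto
    moreover have "infinite {u $ i<..<v $ i}" using uv by (simp add: infinite_Ioo)
    ultimately show False using schur_ratio_not_const[OF a b _ u] by blast
  qed
qed

theorem theorem1p5:
  fixes m n :: "real ^ ('n::{finite, linorder})"
  assumes "strict_mono (($) m)" and "strict_mono (($) n)"
    and "m \<noteq> n"
    and "\<forall>j. m $ j \<le> n $ j"
  shows "(\<forall>u \<in> pos_orthant_distinct. det (entrywise_powr u m) \<noteq> 0)
    \<and> symmetric_on pos_orthant_distinct (det_ratio m n)
    \<and> strictly_increasing_each_coord_on pos_orthant_distinct (det_ratio m n)
    \<and> (\<forall>a b :: (nat, 'n) vec. m = (\<chi> j. real (a $ j)) \<and> n = (\<chi> j. real (b $ j)) \<longrightarrow>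
         (\<forall>u \<in> pos_orthant. schur a u \<noteq> 0)
       \<and> continuous_on pos_orthant (\<lambda>u. schur b u / schur a u)
       \<and> (\<forall>u \<in> pos_orthant_distinct. schur b u / schur a u = det_ratio m n u)
       \<and> (\<forall>g. continuous_on pos_orthant g \<and> (\<forall>u \<in> pos_orthant_distinct. g u = det_ratio m n u)
             \<longrightarrow> (\<forall>u \<in> pos_orthant. g u = schur b u / schur a u))
       \<and> strictly_increasing_each_coord_on pos_orthant (\<lambda>u. schur b u / schur a u))"
proof (intro conjI)
  show "\<forall>u \<in> pos_orthant_distinct. det (entrywise_powr u m) \<noteq> 0"
    using det_entrywise_powr_nonzero strict_mono_nth_inj[OF assms(1)] by blast
  show "symmetric_on pos_orthant_distinct (det_ratio m n)" by (rule det_ratio_symmetric)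
  show "strictly_increasing_each_coord_on pos_orthant_distinct (det_ratio m n)"
    unfolding strictly_increasing_each_coord_on_def
    using det_ratio_less_or_eq[OF assms(1,2)] assms(3,4) by blast
  show "\<forall>a b :: (nat, 'n) vec. m = (\<chi> j. real (a $ j)) \<and> n = (\<chi> j. real (b $ j)) \<longrightarrow>
         (\<forall>u \<in> pos_orthant. schur a u \<noteq> 0)
       \<and> continuous_on pos_orthant (\<lambda>u. schur b u / schur a u)
       \<and> (\<forall>u \<in> pos_orthant_distinct. schur b u / schur a u = det_ratio m n u)
       \<and> (\<forall>g. continuous_on pos_orthant g \<and> (\<forall>u \<in> pos_orthant_distinct. g u = det_ratio m n u)
             \<longrightarrow> (\<forall>u \<in> pos_orthant. g u = schur b u / schur a u))
       \<and> strictly_increasing_each_coord_on pos_orthant (\<lambda>u. schur b u / schur a u)"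
  proof (intro allI impI)
    fix a b :: "(nat, 'n) vec"
    assume mn: "m = (\<chi> j. real (a $ j)) \<and> n = (\<chi> j. real (b $ j))"
    have a: "strict_mono (($) a)" and b: "strict_mono (($) b)"
      using assms(1,2) mn by (auto simp: strict_mono_def)
    have ab: "\<And>j. a $ j \<le> b $ j" "a \<noteq> b" using assms(3,4) mn by auto
    have ratio: "schur b u / schur a u = det_ratio m n u" if "u \<in> pos_orthant_distinct" for u
      using schur_ratio_eq_det_ratio[OF that] mn by simp
    have "g u = schur b u / schur a u"
      if "continuous_on pos_orthant g" "\<forall>u \<in> pos_orthant_distinct. g u = det_ratio m n u" "u \<in> pos_orthant"
      for g u
      using continuous_eq_on_pos_orthant_distinct[OF that(1) continuous_on_schur_ratio[OF a] _ that(3)]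
        that(2) ratio by simp
    then show "(\<forall>u \<in> pos_orthant. schur a u \<noteq> 0)
       \<and> continuous_on pos_orthant (\<lambda>u. schur b u / schur a u)
       \<and> (\<forall>u \<in> pos_orthant_distinct. schur b u / schur a u = det_ratio m n u)
       \<and> (\<forall>g. continuous_on pos_orthant g \<and> (\<forall>u \<in> pos_orthant_distinct. g u = det_ratio m n u)
             \<longrightarrow> (\<forall>u \<in> pos_orthant. g u = schur b u / schur a u))
       \<and> strictly_increasing_each_coord_on pos_orthant (\<lambda>u. schur b u / schur a u)"
      using less_imp_neq[OF schur_pos[OF a], symmetric] continuous_on_schur_ratio[OF a] ratio
        schur_ratio_strictly_increasing[OF a b ab]
      by (intro conjI) blast+
  qed
qed

end
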